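(* For every Lipschitz function $f:\mathbb{R}\to\mathbb{R}$, $$\bar{R}_1(f) = \big\|\sqrt{1+x^2}\,f''\big\|_{\mathrm{TV}} = \int_{\mathbb{R}}\sqrt{1+x^2}\; \mathrm{d}|f''|(x).$$ For every non-Lipschitz function $f:\mathbb{R}\to\mathbb{R}$, $\bar{R}_1(f) = +\infty$.
   Context: Let $\sigma(z)=\max(0,z)$. For $m\in\mathbb{N}$, $\theta=(a_j,w_j,b_j)_{j\in[m]}\in\mathbb{R}^{3m}$ and $(a_0,b_0)\in\mathbb{R}^2$, let $f_{\theta,a_0,b_0}(x)=a_0x+b_0+\sum_{j=1}^m a_j\sigma(w_jx+b_j)$ and $\|\theta\|_2^2=\sum_{j=1}^m (a_j^2+w_j^2+b_j^2)$. For $f:\mathbb{R}\to\mathbb{R}$ the representational cost with a free skip connection is $$\bar{R}_1(f)=\lim_{\varepsilon\to0^+}\Big(\inf_{m\in\mathbb{N},\,\theta\in\mathbb{R}^{3m},\,(a_0,b_0)\in\mathbb{R}^2}\tfrac12\|\theta\|_2^2\ \text{ such that } |f_{\theta,a_0,b_0}(x)-f(x)|\le\varepsilon \text{ for all } x\in[-1/\varepsilon,1/\varepsilon]\Big)\in[0,+\infty],$$ with the infimum over an empty set equal to $+\infty$. For Lipschitz $f$, $f''$ is the distributional second derivative of $f$. If $f''$ is a signed Radon measure with total variation measure $|f''|$, then $\|\sqrt{1+x^2}f''\|_{\mathrm{TV}}=\int_{\mathbb{R}}\sqrt{1+x^2}\,\mathrm{d}|f''|(x)\in[0,+\infty]$;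 if $f''$ is not a measure, this quantity is $+\infty$. *)

theory Defs
  imports "HOL-Analysis.Analysis"
begin

section \<open>Shallow ReLU networks with a free skip connection\<close>

definition relu :: "real \<Rightarrow> real" where
  "relu z = max 0 z"

text \<open>
  A parameter vector in \<open>\<real>\<^sup>3\<^sup>m\<close> is given by three families indexed by \<open>1, \<dots>, m\<close>; their values
  outside \<open>{1..m}\<close> are never used.
\<close>

definition network ::
  "nat \<Rightarrow> (nat \<Rightarrow> real) \<Rightarrow> (nat \<Rightarrow> real) \<Rightarrow> (nat \<Rightarrow> real) \<Rightarrow> real \<Rightarrow> real \<Rightarrow> real \<Rightarrow> real" where
  "network m a w b a0 b0 x = a0 * x + b0 + (\<Sum>j = 1..m. a j * relu (w j * x + b j))"

definition param_norm_sq ::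
  "nat \<Rightarrow> (nat \<Rightarrow> real) \<Rightarrow> (nat \<Rightarrow> real) \<Rightarrow> (nat \<Rightarrow> real) \<Rightarrow> real" where
  "param_norm_sq m a w b = (\<Sum>j = 1..m. (a j)\<^sup>2 + (w j)\<^sup>2 + (b j)\<^sup>2)"

text \<open>In \<^typ>\<open>ennreal\<close>, the infimum of the empty set is \<open>\<infinity>\<close>.\<close>

definition approx_cost :: "(real \<Rightarrow> real) \<Rightarrow> real \<Rightarrow> ennreal" where
  "approx_cost f \<epsilon> =
     Inf {ennreal (1 / 2 * param_norm_sq m a w b) | m a w b a0 b0.
            \<forall>x \<in> {- 1 / \<epsilon>..1 / \<epsilon>}. \<bar>network m a w b a0 b0 x - f x\<bar> \<le> \<epsilon>}"

definition Rbar1 :: "(real \<Rightarrow> real) \<Rightarrow> ennreal" where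
  "Rbar1 f = Lim (at_right 0) (approx_cost f)"

text \<open>The limit exists for every \<open>f\<close>, since the constraint gets stronger as \<open>\<epsilon>\<close> decreases.\<close>

lemma approx_cost_antimono:
  assumes "0 < \<delta>" "\<delta> \<le> \<epsilon>"
  shows "approx_cost f \<epsilon> \<le> approx_cost f \<delta>"
proof -
  have 1: "1 / \<epsilon> \<le> 1 / \<delta>"
    using assms by (simp add: frac_le)
  have "\<forall>x\<in>{- 1 / \<epsilon>..1 / \<epsilon>}. \<bar>network m a w b a0 b0 x - f x\<bar> \<le> \<epsilon>"
    if h: "\<forall>x\<in>{- 1 / \<delta>..1 / \<delta>}. \<bar>network m a w b a0 b0 x - f x\<bar> \<le> \<delta>" for m a w b a0 b0
  proof
    fix x assume "x \<in> {- 1 / \<epsilon>..1 / \<epsilon>}"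
    then have "x \<in> {- 1 / \<delta>..1 / \<delta>}"
      using 1 by auto
    with h assms(2) show "\<bar>network m a w b a0 b0 x - f x\<bar> \<le> \<epsilon>"
      by force
  qed
  then show ?thesis
    unfolding approx_cost_def by (intro Inf_superset_mono) blast
qed

lemma approx_cost_tendsto_Rbar1: "(approx_cost f \<longlongrightarrow> Rbar1 f) (at_right 0)"
proof -
  have "(approx_cost f \<longlongrightarrow> (SUP \<epsilon>\<in>{0<..}. approx_cost f \<epsilon>)) (at_right 0)"
  proof (rule order_tendstoI)
    fix c assume "c < (SUP \<epsilon>\<in>{0<..}. approx_cost f \<epsilon>)"
    then obtain d where d: "0 < d" "c < approx_cost f d"
      by (auto simp: less_SUP_iff)
    have "c < approx_cost f e" if "0 < e" "e < d" for e
      using approx_cost_antimono[of e d f] that d by (meson less_imp_le order_less_le_trans)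
    then show "\<forall>\<^sub>F e in at_right 0. c < approx_cost f e"
      using d(1) by (auto simp: eventually_at_right_field)
  next
    fix c assume c: "(SUP \<epsilon>\<in>{0<..}. approx_cost f \<epsilon>) < c"
    have "approx_cost f e < c" if "0 < e" for e
      using that c by (meson SUP_upper greaterThan_iff order_le_less_trans)
    then show "\<forall>\<^sub>F e in at_right 0. approx_cost f e < c"
      by (auto simp: eventually_at_right_field intro: exI[of _ 1])
  qed
  then show ?thesis
    unfolding Rbar1_def by (simp add: tendsto_Lim)
qed


section \<open>Signed Radon measures on the real line\<close>

text \<open>On \<open>\<real>\<close>, every locally finite Borel measure is inner and outer regular.\<close>

definition radon :: "real measure \<Rightarrow> bool" where
  "radon M \<longleftrightarrow> sets M = sets borel \<and> (\<forall>K. compact K \<longrightarrow> emeasure M K < \<infinity>)"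

definition mutually_singular :: "real measure \<Rightarrow> real measure \<Rightarrow> bool" where
  "mutually_singular P N \<longleftrightarrow> (\<exists>A \<in> sets borel. emeasure P A = 0 \<and> emeasure N (- A) = 0)"

text \<open>
  A signed Radon measure is given by its Jordan decomposition.  Both parts may have infinite total
  mass, so \<^term>\<open>emeasure P A - emeasure N A\<close> need not make sense for unbounded \<open>A\<close>; the integral of
  a compactly supported continuous function always does.
\<close>

typedef signed_radon = "{(P, N). radon P \<and> radon N \<and> mutually_singular P N}"
  by (rule exI[of _ "(null_measure borel, null_measure borel)"])
    (auto simp: radon_def mutually_singular_def)

definition positive_variation :: "signed_radon \<Rightarrow> real measure" where
  "positive_variation \<mu> = fst (Rep_signed_radon \<mu>)"

definition negative_variation :: "signed_radon \<Rightarrow> real measure" where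
  "negative_variation \<mu> = snd (Rep_signed_radon \<mu>)"

definition total_variation :: "signed_radon \<Rightarrow> real measure" where
  "total_variation \<mu> = measure_of UNIV (sets borel)
     (\<lambda>A. emeasure (positive_variation \<mu>) A + emeasure (negative_variation \<mu>) A)"

definition signed_integral :: "signed_radon \<Rightarrow> (real \<Rightarrow> real) \<Rightarrow> real" where
  "signed_integral \<mu> \<phi> =
     (LINT x|positive_variation \<mu>. \<phi> x) - (LINT x|negative_variation \<mu>. \<phi> x)"

lemma sets_variation [simp]:
  "sets (positive_variation \<mu>) = sets borel" "sets (negative_variation \<mu>) = sets borel"
  using Rep_signed_radon[of \<mu>] by (auto simp: positive_variation_def negative_variation_def radon_def)

lemma sets_total_variation [simp]: "sets (total_variation \<mu>) = sets borel"
  using sets.sigma_sets_eq[of "borel :: real measure"] by (simp add: total_variation_def)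

lemma emeasure_total_variation:
  assumes "A \<in> sets borel"
  shows "emeasure (total_variation \<mu>) A =
    emeasure (positive_variation \<mu>) A + emeasure (negative_variation \<mu>) A"
proof -
  let ?P = "positive_variation \<mu>" and ?N = "negative_variation \<mu>"
  have "countably_additive (sets borel) (\<lambda>A. emeasure ?P A + emeasure ?N A)"
  proof (rule countably_additiveI)
    fix B :: "nat \<Rightarrow> real set"
    assume B: "range B \<subseteq> sets borel" "disjoint_family B" "(\<Union>i. B i) \<in> sets borel"
    then show "(\<Sum>i. emeasure ?P (B i) + emeasure ?N (B i)) =
        emeasure ?P (\<Union>i. B i) + emeasure ?N (\<Union>i. B i)"
      by (subst suminf_add[symmetric]) (auto simp: suminf_emeasure)
  qed
  then show ?thesis
    unfolding total_variation_def
    using assms sets.sigma_algebra_axioms[of "borel :: real measure"]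
    by (subst emeasure_measure_of_sigma) (auto simp: positive_def)
qed


section \<open>The distributional second derivative\<close>

definition test_function :: "(real \<Rightarrow> real) \<Rightarrow> bool" where
  "test_function \<phi> \<longleftrightarrow>
     (\<forall>k. (deriv ^^ k) \<phi> differentiable_on UNIV) \<and> compact (closure {x. \<phi> x \<noteq> 0})"

definition distr_deriv2 :: "(real \<Rightarrow> real) \<Rightarrow> (real \<Rightarrow> real) \<Rightarrow> real" where
  "distr_deriv2 f \<phi> = (LINT x|lborel. f x * (deriv ^^ 2) \<phi> x)"

definition is_deriv2_measure :: "(real \<Rightarrow> real) \<Rightarrow> signed_radon \<Rightarrow> bool" where
  "is_deriv2_measure f \<mu> \<longleftrightarrow>
     (\<forall>\<phi>. test_function \<phi> \<longrightarrow> distr_deriv2 f \<phi> = signed_integral \<mu> \<phi>)"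

text \<open>
  A signed Radon measure is determined by its integrals of test functions, so the choice below is
  from at most one measure.
\<close>

definition weighted_tv_deriv2 :: "(real \<Rightarrow> real) \<Rightarrow> ennreal" where
  "weighted_tv_deriv2 f =
     (if \<exists>\<mu>. is_deriv2_measure f \<mu>
      then \<integral>\<^sup>+ x. ennreal (sqrt (1 + x\<^sup>2)) \<partial>total_variation (SOME \<mu>. is_deriv2_measure f \<mu>)
      else \<infinity>)"

end

theory Submission
  imports Defs "HOL-Probability.Helly_Selection"
begin

text \<open>
  A neuron \<open>a relu (w x + b)\<close> contributes \<open>a \<bar>w\<bar> \<delta>\<close> at the breakpoint \<open>- b / w\<close> to the second derivative, and
  AM-GM gives \<open>\<bar>a\<bar> \<bar>w\<bar> sqrt (1 + (b / w)\<^sup>2) \<le> (a\<^sup>2 + w\<^sup>2 + b\<^sup>2) / 2\<close>, with equality after rescaling.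
  The link between measures and networks is the identity \<open>\<integral> hat d\<mu> = \<close> second difference of \<open>f\<close> for
  piecewise linear hat functions, obtained from smooth test functions by mollification.
  Upper bound: the piecewise linear interpolant of \<open>f\<close> is a network whose cost is at most
  \<open>(1 + h) \<integral> sqrt (1 + x\<^sup>2) d\<bar>\<mu>\<bar>\<close>, where \<open>h\<close> is the mesh size.
  Lower bound: second differences of approximating networks converge to those of \<open>f\<close>, so \<open>\<integral> \<psi> d\<mu> \<le> Rbar1 f\<close>
  for all continuous compactly supported \<open>\<psi>\<close> below the weight; inner regularity then replaces \<open>\<psi>\<close> by the
  weight times the sign of \<open>\<mu>\<close>. If the cost is finite, Helly selection applied to the positive and
  the negative atoms of the approximating networks produces the measure \<open>\<mu>\<close>, and the slopes of the networks
  are bounded, so \<open>f\<close> is Lipschitz.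
\<close>

section \<open>Hat functions and networks\<close>

text \<open>The distributional identity speaks of smooth test functions, whereas networks have kinks
  at arbitrary places. Hat functions mediate between the two: integrated against \<mu> they give
  values of \<open>f\<close> at finitely many points, where pointwise convergence of networks can be
  used, and as a partition of unity they interpolate the weight and continuous functions below it.
  Interpolating the weight on a mesh h costs at most a factor 1 + h, which disappears as h tends to
  0; in the upper bound this happens at fixed \<epsilon>.

  The skip connection is free and invisible to second differences, so its slope is controlled only
  through values of \<open>f\<close>. In the Helly step atoms may escape to infinity, and the limits
  of the positive and of the negative atoms may overlap. Hence that step supplies only the existence
  of \<mu>, with singularity restored by a Jordan decomposition, while the sharp lower bound is a
  duality argument valid for every measure that represents the second derivative.\<close>

definition weight :: "real \<Rightarrow> real" where
  "weight x = sqrt (1 + x\<^sup>2)"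

lemma weight_ge_1: "1 \<le> weight x"
  by (simp add: weight_def)

lemma weight_pos: "0 < weight x"
  using weight_ge_1[of x] by linarith

text \<open>\<open>weight x\<close> is the Euclidean norm of the vector (1, x), so this is the
  reverse triangle inequality.\<close>

lemma abs_weight_diff_le: "\<bar>weight x - weight y\<bar> \<le> \<bar>x - y\<bar>"
proof -
  have "weight x \<le> weight y + \<bar>x - y\<bar>" for x y
  proof -
    have "\<bar>y\<bar> \<le> weight y"
      unfolding weight_def by (rule real_le_rsqrt) simp
    then have "y * (x - y) \<le> weight y * \<bar>x - y\<bar>"
      by (metis abs_ge_self abs_ge_zero abs_mult mult_right_mono order_trans)
    moreover have "(weight y)\<^sup>2 = 1 + y\<^sup>2"
      by (simp add: weight_def)
    ultimately have "1 + x\<^sup>2 \<le> (weight y + \<bar>x - y\<bar>)\<^sup>2"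
      by (simp add: power2_eq_square algebra_simps abs_mult_self_eq)
    then show ?thesis
      unfolding weight_def[of x] using weight_pos[of y] by (intro real_le_lsqrt) auto
  qed
  from this[of x y] this[of y x] show ?thesis
    by (simp add: abs_le_iff abs_minus_commute)
qed

lemma continuous_on_weight [continuous_intros]: "continuous_on S weight"
  unfolding weight_def by (intro continuous_intros)

lemma borel_measurable_weight [measurable]: "weight \<in> borel_measurable borel"
  by (intro borel_measurable_continuous_onI continuous_on_weight)

text \<open>Linear in shifted copies of \<^const>\<open>relu\<close>, so that sums over a grid telescope and second
  differences of networks are combinations of hat functions.\<close>

definition hat :: "real \<Rightarrow> real \<Rightarrow> real \<Rightarrow> real" where
  "hat h t x = (relu (x - t + h) - 2 * relu (x - t) + relu (x - t - h)) / h"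

text \<open>Divided by h and not by its square: this is the jump at t of the slope of the piecewise
  linear interpolant of mesh h, that is, the mass at t of the interpolant's second
  derivative.\<close>

definition second_diff :: "real \<Rightarrow> (real \<Rightarrow> real) \<Rightarrow> real \<Rightarrow> real" where
  "second_diff h f t = (f (t + h) - 2 * f t + f (t - h)) / h"

lemma hat_nonneg: "0 < h \<Longrightarrow> 0 \<le> hat h t x"
  by (auto simp: hat_def relu_def max_def)

lemma hat_le_1: "0 < h \<Longrightarrow> hat h t x \<le> 1"
  by (auto simp: hat_def relu_def max_def field_simps)

lemma hat_eq_0: "0 < h \<Longrightarrow> h \<le> \<bar>x - t\<bar> \<Longrightarrow> hat h t x = 0"
  by (auto simp: hat_def relu_def max_def abs_if split: if_splits)

lemma continuous_on_relu [continuous_intros]: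
  "continuous_on S f \<Longrightarrow> continuous_on S (\<lambda>x. relu (f x))"
  unfolding relu_def by (intro continuous_intros)

lemma continuous_on_hat: "continuous_on S (hat h t)"
  unfolding hat_def divide_inverse by (intro continuous_intros)

lemma borel_measurable_hat [measurable]: "hat h t \<in> borel_measurable borel"
  by (intro borel_measurable_continuous_onI continuous_on_hat)

text \<open>A hat is the difference of two adjacent ramps of slope 1 / h, so the sum telescopes to
  the first ramp minus the last one.\<close>

lemma sum_hat:
  assumes "0 < h"
  shows "(\<Sum>k = 1..n. hat h (t + real k * h) x) =
    (relu (x - t) - relu (x - t - h) - relu (x - t - real n * h) + relu (x - t - real (Suc n) * h)) / h"
proof (induction n)
  case (Suc n)
  have "hat h (t + real (Suc n) * h) x = (relu (x - t - real n * h)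
      - 2 * relu (x - t - real (Suc n) * h) + relu (x - t - real (Suc (Suc n)) * h)) / h"
    by (simp add: hat_def algebra_simps)
  with Suc show ?case
    by (simp add: add_divide_distrib diff_divide_distrib)
qed simp

lemma sum_hat_le_1:
  assumes "0 < h"
  shows "(\<Sum>k = 1..n. hat h (t + real k * h) x) \<le> 1"
proof -
  have "relu (x - t) - relu (x - t - h) \<le> h"
    using assms by (auto simp: relu_def max_def)
  moreover have "relu (x - t - real (Suc n) * h) \<le> relu (x - t - real n * h)"
    using assms by (auto simp: relu_def max_def algebra_simps)
  ultimately show ?thesis
    unfolding sum_hat[OF assms] using assms by (simp add: field_simps)
qed

lemma sum_hat_eq_1:
  assumes "0 < h" "t + h \<le> x" "x \<le> t + real n * h"
  shows "(\<Sum>k = 1..n. hat h (t + real k * h) x) = 1"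
proof -
  have "relu (x - t) - relu (x - t - h) = h" "relu (x - t - real n * h) = 0"
      "relu (x - t - real (Suc n) * h) = 0"
    using assms by (auto simp: relu_def max_def algebra_simps)
  then show ?thesis
    unfolding sum_hat[OF assms(1)] using assms by simp
qed

text \<open>The hats sum to 1 on the inner part of the grid and to at most 1 everywhere, so the
  interpolant averages the values at the nodes near x. The alternative \<open>v = 0\<close> admits
  points off the grid and also yields plain bounds on the interpolant.\<close>

lemma hat_interpolation_error:
  assumes h: "0 < h" and e: "0 \<le> e"
    and u: "\<And>k. k \<in> {1..n} \<Longrightarrow> \<bar>x - (t + real k * h)\<bar> < h \<Longrightarrow> \<bar>u k - v\<bar> \<le> e"
    and v: "v = 0 \<or> t + h \<le> x \<and> x \<le> t + real n * h"
  shows "\<bar>(\<Sum>k = 1..n. u k * hat h (t + real k * h) x) - v\<bar> \<le> e"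
proof -
  let ?H = "\<lambda>k. hat h (t + real k * h) x"
  have "v = (\<Sum>k = 1..n. v * ?H k)"
    using v sum_hat_eq_1[OF h, of t x n] by (auto simp: sum_distrib_left[symmetric])
  then have "\<bar>(\<Sum>k = 1..n. u k * ?H k) - v\<bar> = \<bar>\<Sum>k = 1..n. (u k - v) * ?H k\<bar>"
    by (simp add: left_diff_distrib sum_subtractf)
  also have "\<dots> \<le> (\<Sum>k = 1..n. \<bar>(u k - v) * ?H k\<bar>)"
    by (rule sum_abs)
  also have "\<dots> \<le> (\<Sum>k = 1..n. e * ?H k)"
  proof (rule sum_mono)
    fix k assume k: "k \<in> {1..n}"
    show "\<bar>(u k - v) * ?H k\<bar> \<le> e * ?H k"
    proof (cases "\<bar>x - (t + real k * h)\<bar> < h")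
      case True
      with u[OF k] hat_nonneg[OF h] show ?thesis
        by (simp add: abs_mult mult_right_mono)
    next
      case False
      then show ?thesis
        using hat_eq_0[OF h, of x "t + real k * h"] by simp
    qed
  qed
  also have "\<dots> \<le> e"
    using e sum_hat_le_1[OF h, of t x n] by (simp add: sum_distrib_left[symmetric] mult_left_le)
  finally show ?thesis .
qed

text \<open>Only nodes within h of x contribute, and there the weight is at most
  \<open>weight x + h\<close>, hence at most \<open>(1 + h) * weight x\<close> because the weight is
  at least 1. This is the origin of the factor 1 + h in both inequalities.\<close>

lemma hat_interpolation_weight_le:
  assumes h: "0 < h"
  shows "(\<Sum>k = 1..n. weight (t + real k * h) * hat h (t + real k * h) x) \<le> (1 + h) * weight x"
proof -
  let ?H = "\<lambda>k. hat h (t + real k * h) x"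
  have "(\<Sum>k = 1..n. weight (t + real k * h) * ?H k) \<le> (\<Sum>k = 1..n. (1 + h) * weight x * ?H k)"
  proof (rule sum_mono)
    fix k
    show "weight (t + real k * h) * ?H k \<le> (1 + h) * weight x * ?H k"
    proof (cases "\<bar>x - (t + real k * h)\<bar> < h")
      case True
      have "weight (t + real k * h) \<le> weight x + h"
        using abs_weight_diff_le[of x "t + real k * h"] True by linarith
      also have "\<dots> \<le> (1 + h) * weight x"
        using h weight_ge_1[of x] by (simp add: algebra_simps)
      finally show ?thesis
        using hat_nonneg[OF h] by (rule mult_right_mono)
    next
      case False
      then show ?thesis
        using hat_eq_0[OF h, of x "t + real k * h"] by simp
    qed
  qed
  also have "\<dots> \<le> (1 + h) * weight x"
    using h weight_pos[of x] sum_hat_le_1[OF h, of t x n]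
    by (simp add: sum_distrib_left[symmetric] mult_left_le)
  finally show ?thesis .
qed

section \<open>Second differences and the cost of neurons\<close>

text \<open>A neuron is \<bar>w\<bar> times a shifted and possibly reflected ReLU. Reflection
  changes the ReLU by a linear function, which a second difference does not see. For w = 0 the
  breakpoint is the default value 0 of the division, with mass 0.\<close>

lemma second_diff_relu:
  assumes "0 < h"
  shows "second_diff h (\<lambda>x. relu (w * x + b)) t = \<bar>w\<bar> * hat h t (- b / w)"
proof -
  have pos: "relu (c * y) = c * relu y" if "0 \<le> c" for c y
    using that by (auto simp: relu_def max_def mult_le_0_iff zero_le_mult_iff)
  have refl: "relu (- u + h) - 2 * relu (- u) + relu (- u - h) = relu (u + h) - 2 * relu u + relu (u - h)" for u
    using assms by (auto simp: relu_def max_def)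
  have hat1: "second_diff h (\<lambda>x. relu (- (x - s))) t = hat h t s" for s
    by (simp add: second_diff_def hat_def algebra_simps)
  have hat2: "second_diff h (\<lambda>x. relu (x - s)) t = hat h t s" for s
    using refl[of "t - s"] by (simp add: second_diff_def hat_def algebra_simps)
  have scale: "second_diff h (\<lambda>x. c * g x) t = c * second_diff h g t" for c g
    by (simp add: second_diff_def algebra_simps)
  consider "w = 0" | "0 < w" | "w < 0" by linarith
  then show ?thesis
  proof cases
    case 1
    then show ?thesis by (simp add: second_diff_def)
  next
    case 2
    then have "(\<lambda>x. relu (w * x + b)) = (\<lambda>x. w * relu (x - (- b / w)))"
      using pos[of w] by (simp add: algebra_simps flip: pos)
    with 2 show ?thesis
      by (simp only: scale hat2 abs_of_pos)
  next
    case 3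
    then have "relu (w * x + b) = (- w) * relu (- (x - (- b / w)))" for x
      using pos[of "- w" "- (x - (- b / w))"] by (simp add: algebra_simps)
    then have "(\<lambda>x. relu (w * x + b)) = (\<lambda>x. (- w) * relu (- (x - (- b / w))))"
      by (rule ext)
    with 3 show ?thesis
      by (simp only: scale hat1 abs_of_neg)
  qed
qed

lemma second_diff_network:
  assumes "0 < h"
  shows "second_diff h (network m a w b a0 b0) t = (\<Sum>j = 1..m. a j * \<bar>w j\<bar> * hat h t (- b j / w j))"
proof -
  have "second_diff h (network m a w b a0 b0) t =
      (\<Sum>j = 1..m. a j * second_diff h (\<lambda>x. relu (w j * x + b j)) t)"
    using assms
    by (simp add: second_diff_def network_def sum_distrib_left sum_subtractf[symmetric]
        sum.distrib[symmetric] sum_divide_distrib algebra_simps)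
  then show ?thesis
    using second_diff_relu[OF assms] by (simp add: mult.assoc)
qed

text \<open>For nonzero w both sides are the norm of (w, b): the weight at the breakpoint records
  the bias. For w = 0 the left side vanishes while a constant neuron may still have a bias, whence
  only an inequality.\<close>

lemma abs_weight_breakpoint: "\<bar>w\<bar> * weight (- b / w) \<le> sqrt (w\<^sup>2 + b\<^sup>2)"
proof (cases "w = 0")
  case False
  have "\<bar>w\<bar> * weight (- b / w) = sqrt (w\<^sup>2 * (1 + (- b / w)\<^sup>2))"
    by (simp add: weight_def real_sqrt_mult)
  also have "w\<^sup>2 * (1 + (- b / w)\<^sup>2) = w\<^sup>2 + b\<^sup>2"
    using False by (simp add: power_divide field_simps)
  finally show ?thesis by simp
qed simp

lemma sum_weight_breakpoint_le:
  "(\<Sum>j = 1..m. \<bar>a j\<bar> * \<bar>w j\<bar> * weight (- b j / w j)) \<le> 1 / 2 * param_norm_sq m a w b"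
proof -
  have "\<bar>a\<bar> * \<bar>w\<bar> * weight (- b / w) \<le> 1 / 2 * (a\<^sup>2 + w\<^sup>2 + b\<^sup>2)" for a w b :: real
  proof -
    have "\<bar>a\<bar> * \<bar>w\<bar> * weight (- b / w) \<le> \<bar>a\<bar> * sqrt (w\<^sup>2 + b\<^sup>2)"
      using abs_weight_breakpoint[of w b] by (simp add: mult.assoc mult_left_mono)
    also have "\<dots> \<le> 1 / 2 * (a\<^sup>2 + w\<^sup>2 + b\<^sup>2)"
      using sum_squares_bound[of "\<bar>a\<bar>" "sqrt (w\<^sup>2 + b\<^sup>2)"] by simp
    finally show ?thesis .
  qed
  then show ?thesis
    unfolding param_norm_sq_def sum_distrib_left by (intro sum_mono)
qed

text \<open>The sum is the pairing of \<psi> with the second derivative of the network, a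
  combination of point masses. The cost thus bounds the norm of this functional dual to the
  weight.\<close>

lemma abs_sum_breakpoint_le:
  assumes "\<And>x. \<bar>\<psi> x\<bar> \<le> c * weight x"
  shows "\<bar>\<Sum>j = 1..m. a j * \<bar>w j\<bar> * \<psi> (- b j / w j)\<bar> \<le> c * (1 / 2 * param_norm_sq m a w b)"
proof -
  have c: "0 \<le> c"
    using assms[of 0] by (simp add: weight_def)
  have "\<bar>\<Sum>j = 1..m. a j * \<bar>w j\<bar> * \<psi> (- b j / w j)\<bar> \<le> (\<Sum>j = 1..m. \<bar>a j * \<bar>w j\<bar> * \<psi> (- b j / w j)\<bar>)"
    by (rule sum_abs)
  also have "\<dots> \<le> (\<Sum>j = 1..m. c * (\<bar>a j\<bar> * \<bar>w j\<bar> * weight (- b j / w j)))"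
  proof (rule sum_mono)
    fix j
    have "\<bar>a j\<bar> * \<bar>w j\<bar> * \<bar>\<psi> (- b j / w j)\<bar> \<le> \<bar>a j\<bar> * \<bar>w j\<bar> * (c * weight (- b j / w j))"
      by (intro mult_left_mono assms) simp
    then show "\<bar>a j * \<bar>w j\<bar> * \<psi> (- b j / w j)\<bar> \<le> c * (\<bar>a j\<bar> * \<bar>w j\<bar> * weight (- b j / w j))"
      by (simp add: abs_mult mult_ac)
  qed
  also have "\<dots> \<le> c * (1 / 2 * param_norm_sq m a w b)"
    unfolding sum_distrib_left[symmetric] using c sum_weight_breakpoint_le by (intro mult_left_mono)
  finally show ?thesis .
qed

section \<open>Smooth functions and test functions\<close>

text \<open>Smoothness is witnessed by a tower of derivatives, so closure properties only require
  exhibiting a tower, without computing iterates of \<open>deriv\<close>.\<close>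

definition smooth :: "(real \<Rightarrow> real) \<Rightarrow> bool" where
  "smooth f \<longleftrightarrow> (\<exists>D. D 0 = f \<and> (\<forall>k x. (D k has_real_derivative D (Suc k) x) (at x)))"

lemma deriv_power_eq:
  assumes "D 0 = f" "\<And>k x. (D k has_real_derivative D (Suc k) x) (at x)"
  shows "(deriv ^^ k) f = D k"
proof (induction k)
  case (Suc k)
  then show ?case
    by (auto intro!: ext DERIV_imp_deriv assms(2))
qed (simp add: assms(1))

lemma smoothD:
  assumes "smooth f"
  shows "((deriv ^^ k) f has_real_derivative (deriv ^^ Suc k) f x) (at x)"
  using assms deriv_power_eq unfolding smooth_def by metis

lemma smooth_add:
  assumes "smooth f" "smooth g"
  shows "smooth (\<lambda>x. f x + g x)"
  unfolding smooth_def using smoothD[OF assms(1)] smoothD[OF assms(2)]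
  by (intro exI[of _ "\<lambda>k x. (deriv ^^ k) f x + (deriv ^^ k) g x"]) (auto intro!: DERIV_add)

lemma smooth_cmult:
  assumes "smooth f"
  shows "smooth (\<lambda>x. c * f x)"
  unfolding smooth_def using smoothD[OF assms]
  by (intro exI[of _ "\<lambda>k x. c * (deriv ^^ k) f x"]) (auto intro!: DERIV_cmult)

lemma smooth_affine:
  assumes "smooth f"
  shows "smooth (\<lambda>x. f (c * x + d))"
  unfolding smooth_def
proof (intro exI[of _ "\<lambda>k x. c ^ k * (deriv ^^ k) f (c * x + d)"] conjI allI)
  fix k x
  have "((\<lambda>x. (deriv ^^ k) f (c * x + d)) has_real_derivative (deriv ^^ Suc k) f (c * x + d) * c) (at x)"
    by (rule DERIV_chain2[OF smoothD[OF assms]]) (auto intro!: derivative_eq_intros)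
  from DERIV_cmult[OF this, of "c ^ k"]
  show "((\<lambda>x. c ^ k * (deriv ^^ k) f (c * x + d)) has_real_derivative
      c ^ Suc k * (deriv ^^ Suc k) f (c * x + d)) (at x)"
    by (simp add: mult_ac)
qed simp

lemma smooth_antiderivative:
  assumes "smooth g" "\<And>x. (f has_real_derivative g x) (at x)"
  shows "smooth f"
  unfolding smooth_def using smoothD[OF assms(1)] assms(2)
  by (intro exI[of _ "case_nat f (\<lambda>k. (deriv ^^ k) g)"]) (auto split: nat.split)

text \<open>A family closed under differentiation contains only smooth functions. This avoids any
  formula for the k-th derivative of a bump.\<close>

lemma smooth_coinduct:
  assumes "f \<in> S" "\<And>g. g \<in> S \<Longrightarrow> \<exists>g' \<in> S. \<forall>x. (g has_real_derivative g' x) (at x)"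
  shows "smooth f"
proof -
  obtain N where N: "\<And>g. g \<in> S \<Longrightarrow> N g \<in> S \<and> (\<forall>x. (g has_real_derivative N g x) (at x))"
    using assms(2) by metis
  have "(N ^^ k) f \<in> S" for k
    by (induction k) (use N assms(1) in auto)
  then show ?thesis
    unfolding smooth_def using N by (intro exI[of _ "\<lambda>k. (N ^^ k) f"]) auto
qed

lemma test_function_iff:
  "test_function \<phi> \<longleftrightarrow> smooth \<phi> \<and> (\<exists>R. \<forall>x. R \<le> \<bar>x\<bar> \<longrightarrow> \<phi> x = 0)"
proof -
  have "(\<forall>k. (deriv ^^ k) \<phi> differentiable_on UNIV) \<longleftrightarrow> smooth \<phi>"
  proof
    assume *: "\<forall>k. (deriv ^^ k) \<phi> differentiable_on UNIV"
    have "((deriv ^^ k) \<phi> has_real_derivative (deriv ^^ Suc k) \<phi> x) (at x)" for k x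
      using * by (auto simp: differentiable_on_def DERIV_deriv_iff_real_differentiable)
    then show "smooth \<phi>"
      unfolding smooth_def by (intro exI[of _ "\<lambda>k. (deriv ^^ k) \<phi>"]) auto
  next
    assume "smooth \<phi>"
    then show "\<forall>k. (deriv ^^ k) \<phi> differentiable_on UNIV"
      using smoothD real_differentiable_def by (auto simp: differentiable_on_def)
  qed
  moreover have "compact (closure {x. \<phi> x \<noteq> 0}) \<longleftrightarrow> (\<exists>R. \<forall>x. R \<le> \<bar>x\<bar> \<longrightarrow> \<phi> x = 0)"
  proof
    assume "compact (closure {x. \<phi> x \<noteq> 0})"
    then have "bounded {x. \<phi> x \<noteq> 0}"
      by (meson bounded_closure_image bounded_subset closure_subset compact_imp_bounded)
    then obtain R where "\<And>x. \<phi> x \<noteq> 0 \<Longrightarrow> \<bar>x\<bar> \<le> R"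
      by (auto simp: bounded_iff)
    then show "\<exists>R. \<forall>x. R \<le> \<bar>x\<bar> \<longrightarrow> \<phi> x = 0"
      by (intro exI[of _ "R + 1"]) force
  next
    assume "\<exists>R. \<forall>x. R \<le> \<bar>x\<bar> \<longrightarrow> \<phi> x = 0"
    then obtain R where "\<And>x. R \<le> \<bar>x\<bar> \<Longrightarrow> \<phi> x = 0" by auto
    then have "bounded {x. \<phi> x \<noteq> 0}"
      by (intro boundedI[of _ R]) (force simp: not_le)
    then show "compact (closure {x. \<phi> x \<noteq> 0})"
      by (simp add: compact_closure)
  qed
  ultimately show ?thesis
    by (simp add: test_function_def)
qed

section \<open>A smooth approximation of the ReLU\<close>

text \<open>The polynomial and the power make this family closed under differentiation.\<close>

definition bump :: "real poly \<Rightarrow> nat \<Rightarrow> real \<Rightarrow> real" where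
  "bump p n x = (if 0 < x \<and> x < 1
     then poly p x * inverse (x * (1 - x)) ^ n * exp (- inverse (x * (1 - x))) else 0)"

lemma power_div_fact_le_exp: "0 \<le> (x::real) \<Longrightarrow> x ^ k / fact k \<le> exp x"
proof -
  assume "0 \<le> x"
  then have "(\<Sum>i\<in>{k}. inverse (fact i) * x ^ i) \<le> (\<Sum>i. inverse (fact i) * x ^ i)"
    by (intro sum_le_suminf summable_exp) auto
  then show ?thesis
    by (simp add: exp_def field_simps)
qed

text \<open>With v = 1 / (x (1 - x)), the factor exp (- v) absorbs n + 2 powers of v: n of them are
  present, and the other two leave the square of x (1 - x). A quadratic bound at 0 and at 1 gives
  derivative 0 at these junction points.\<close>

lemma bump_quadratic_bound:
  obtains K where "\<And>x. \<bar>bump p n x\<bar> \<le> K * x\<^sup>2" "\<And>x. \<bar>bump p n x\<bar> \<le> K * (x - 1)\<^sup>2"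
proof -
  have "compact (poly p ` {0..1})"
    by (intro compact_continuous_image continuous_intros) auto
  then have "bounded (poly p ` {0..1})"
    by (rule compact_imp_bounded)
  then obtain M where "\<forall>x\<in>{0..1}. \<bar>poly p x\<bar> \<le> M"
    by (auto simp: bounded_iff)
  then have M: "\<And>x. 0 \<le> x \<Longrightarrow> x \<le> 1 \<Longrightarrow> \<bar>poly p x\<bar> \<le> M"
    by auto
  have M0: "0 \<le> M"
    using M[of 0] by auto
  let ?K = "M * fact (n + 2)"
  have *: "\<bar>bump p n x\<bar> \<le> ?K * (x * (1 - x))\<^sup>2" if x: "0 < x" "x < 1" for x
  proof -
    define v where "v = inverse (x * (1 - x))"
    have v: "0 < v"
      using x by (simp add: v_def)
    have *: "y / c \<le> e \<Longrightarrow> 0 < c \<Longrightarrow> y * inverse e \<le> c" if "0 < e" for y c e :: real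
      using that by (simp add: field_simps)
    \<comment> \<open>The constant comes from the term of degree n + 2 of the exponential
      series.\<close>
    have "v ^ (n + 2) * exp (- v) \<le> fact (n + 2)"
      unfolding exp_minus using v by (intro * power_div_fact_le_exp) auto
    then have "v ^ (n + 2) * exp (- v) * (x * (1 - x))\<^sup>2 \<le> fact (n + 2) * (x * (1 - x))\<^sup>2"
      by (rule mult_right_mono) simp
    moreover have "v * (x * (1 - x)) = 1"
      using x by (simp add: v_def del: inverse_mult_distrib)
    moreover have "v ^ (n + 2) * exp (- v) * (x * (1 - x))\<^sup>2 = v ^ n * exp (- v) * (v * (x * (1 - x)))\<^sup>2"
      by (simp add: power_add power_mult_distrib power2_eq_square)
    ultimately have "v ^ n * exp (- v) \<le> fact (n + 2) * (x * (1 - x))\<^sup>2"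
      by (metis mult_1_right power_one)
    then have "\<bar>poly p x\<bar> * (v ^ n * exp (- v)) \<le> M * (fact (n + 2) * (x * (1 - x))\<^sup>2)"
      using M[of x] M0 x v by (intro mult_mono[OF M]) auto
    then show ?thesis
      unfolding bump_def v_def[symmetric] using x v by (simp add: abs_mult mult.assoc)
  qed
  have "\<bar>bump p n x\<bar> \<le> ?K * x\<^sup>2" "\<bar>bump p n x\<bar> \<le> ?K * (x - 1)\<^sup>2" for x
  proof -
    have "(x * (1 - x))\<^sup>2 \<le> x\<^sup>2 \<and> (x * (1 - x))\<^sup>2 \<le> (x - 1)\<^sup>2" if "0 < x" "x < 1"
      unfolding power2_commute[of x 1] using that
      by (intro conjI power_mono) (simp_all add: mult_left_le mult_left_le_one_le)
    then have "?K * (x * (1 - x))\<^sup>2 \<le> ?K * x\<^sup>2 \<and> ?K * (x * (1 - x))\<^sup>2 \<le> ?K * (x - 1)\<^sup>2" if "0 < x" "x < 1"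
      using that M0 by (intro conjI mult_left_mono) auto
    note le = this
    have "\<bar>bump p n x\<bar> \<le> ?K * x\<^sup>2 \<and> \<bar>bump p n x\<bar> \<le> ?K * (x - 1)\<^sup>2"
    proof (cases "0 < x \<and> x < 1")
      case True
      with le *[of x] show ?thesis by linarith
    next
      case False
      then have "bump p n x = 0"
        by (auto simp: bump_def)
      with M0 show ?thesis by (auto intro!: mult_nonneg_nonneg)
    qed
    then show "\<bar>bump p n x\<bar> \<le> ?K * x\<^sup>2" "\<bar>bump p n x\<bar> \<le> ?K * (x - 1)\<^sup>2"
      by blast+
  qed
  then show thesis by (rule that)
qed

lemma has_derivative_0_if_quadratic:
  fixes F :: "real \<Rightarrow> real"
  assumes "\<And>y. \<bar>F y\<bar> \<le> K * (y - a)\<^sup>2"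
  shows "(F has_real_derivative 0) (at a)"
proof -
  have "F a = 0"
    using assms[of a] by simp
  moreover have "((\<lambda>y. F y / (y - a)) \<longlongrightarrow> 0) (at a)"
  proof (rule Lim_null_comparison)
    show "\<forall>\<^sub>F y in at a. norm (F y / (y - a)) \<le> K * \<bar>y - a\<bar>"
      using assms by (intro eventually_at_topological[THEN iffD2] exI[of _ UNIV])
        (auto simp: field_simps power2_eq_square abs_mult_self_eq)
    show "((\<lambda>y. K * \<bar>y - a\<bar>) \<longlongrightarrow> 0) (at a)"
      by (auto intro!: tendsto_eq_intros)
  qed
  ultimately show ?thesis
    by (simp add: has_field_derivative_iff)
qed

lemma has_derivative_bump:
  "\<exists>q. \<forall>x. (bump p n has_real_derivative bump q (n + 2) x) (at x)"
proof -
  let ?u = "[:0, 1, - 1:] :: real poly" and ?u' = "[:1, - 2:] :: real poly"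
  \<comment> \<open>The derivative of v is - (1 - 2 x) times the square of v, so the product rule
    yields terms with v to the powers n, n + 1 and n + 2. Factors \<open>?u\<close>, that is x (1 -
    x) = 1 / v, bring all of them to the power n + 2.\<close>
  define q where "q = pderiv p * ?u\<^sup>2 - of_nat n * p * ?u * ?u' + p * ?u'"
  have "(bump p n has_real_derivative bump q (n + 2) x) (at x)" for x
  proof -
    obtain K where K: "\<And>y. \<bar>bump p n y\<bar> \<le> K * y\<^sup>2" "\<And>y. \<bar>bump p n y\<bar> \<le> K * (y - 1)\<^sup>2"
      using bump_quadratic_bound[of p n] by metis
    consider "x < 0 \<or> 1 < x" | "x = 0" | "x = 1" | "0 < x" "x < 1"
      by linarith
    then show ?thesis
    proof cases
      case 1
      have "((\<lambda>x. 0) has_real_derivative 0) (at x)"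
        by simp
      moreover have "open (- {0..1::real})"
        by (simp add: open_Compl)
      ultimately have "(bump p n has_real_derivative 0) (at x)"
        by (rule has_field_derivative_transform_within_open) (use 1 in \<open>auto simp: bump_def\<close>)
      with 1 show ?thesis by (auto simp: bump_def)
    next
      case 2
      then show ?thesis
        using has_derivative_0_if_quadratic[of "bump p n" K 0] K by (simp add: bump_def)
    next
      case 3
      then show ?thesis
        using has_derivative_0_if_quadratic[of "bump p n" K 1] K by (simp add: bump_def)
    next
      case 4
      define v where "v = inverse (x * (1 - x))"
      have v: "((\<lambda>x. inverse (x * (1 - x))) has_real_derivative - (1 - 2 * x) * v\<^sup>2) (at x)"
        using 4 by (auto intro!: derivative_eq_intros simp: v_def power2_eq_square field_simps)
      have vn: "((\<lambda>x. inverse (x * (1 - x)) ^ n) has_real_derivative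
          - real n * (1 - 2 * x) * v ^ Suc n) (at x)"
      proof -
        have "real n * (- (1 - 2 * x) * v\<^sup>2 * v ^ (n - Suc 0)) = - real n * (1 - 2 * x) * v ^ Suc n"
          by (cases n) (simp_all add: power2_eq_square algebra_simps)
        with DERIV_power[OF v, of n] show ?thesis
          by (simp only: v_def[symmetric])
      qed
      have uv: "x * (1 - x) * v = 1"
        using 4 by (simp add: v_def del: inverse_mult_distrib)
      have ve: "((\<lambda>x. exp (- inverse (x * (1 - x)))) has_real_derivative exp (- v) * ((1 - 2 * x) * v\<^sup>2)) (at x)"
        using DERIV_fun_exp[OF DERIV_minus[OF v]] by (simp only: v_def[symmetric] minus_mult_left minus_minus)
      have "((\<lambda>x. poly p x * inverse (x * (1 - x)) ^ n * exp (- inverse (x * (1 - x))))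
          has_real_derivative (poly (pderiv p) x * v ^ n * exp (- v)
            + poly p x * (- real n * (1 - 2 * x) * v ^ Suc n) * exp (- v)
            + poly p x * v ^ n * ((1 - 2 * x) * v\<^sup>2 * exp (- v)))) (at x)"
        by (rule DERIV_cong[OF DERIV_mult[OF DERIV_mult[OF poly_DERIV vn] ve]])
          (simp only: v_def[symmetric], simp add: algebra_simps)
      also have "poly (pderiv p) x * v ^ n * exp (- v)
            + poly p x * (- real n * (1 - 2 * x) * v ^ Suc n) * exp (- v)
            + poly p x * v ^ n * ((1 - 2 * x) * v\<^sup>2 * exp (- v)) =
          poly (pderiv p) x * (x * (1 - x) * v)\<^sup>2 * v ^ n * exp (- v)
            + poly p x * (- real n * (1 - 2 * x) * (x * (1 - x) * v) * v ^ Suc n) * exp (- v)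
            + poly p x * v ^ n * ((1 - 2 * x) * v\<^sup>2 * exp (- v))"
        by (simp add: uv)
      also have "\<dots> = bump q (n + 2) x"
        unfolding bump_def v_def[symmetric] using 4
        by (simp add: q_def power_add power2_eq_square algebra_simps)
      finally show ?thesis
        by (rule has_field_derivative_transform_within_open[of _ _ _ "{0<..<1}"])
          (use 4 in \<open>auto simp: bump_def\<close>)
    qed
  qed
  then show ?thesis by blast
qed

lemma smooth_bump: "smooth (bump p n)"
  by (rule smooth_coinduct[where S = "{bump q k | q k. True}"]) (use has_derivative_bump in blast)+

lemma ex_antiderivative:
  fixes g :: "real \<Rightarrow> real"
  assumes "continuous_on UNIV g"
  obtains G where "G a = 0" "\<And>x. (G has_real_derivative g x) (at x)"
proof -
  obtain F where F: "\<And>x. (F has_real_derivative g x) (at x)"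
    using einterval_antiderivative[of "- \<infinity>" \<infinity> g] assms
    by (auto simp: continuous_on_eq_continuous_at has_real_derivative_iff_has_vector_derivative)
  show thesis
    by (rule that[of "\<lambda>x. F x - F a"]) (auto intro!: derivative_eq_intros F)
qed

lemma constant_if_derivative_0:
  fixes G :: "real \<Rightarrow> real"
  assumes "convex S" "\<And>x. (G has_real_derivative g x) (at x)" "\<And>x. x \<in> S \<Longrightarrow> g x = 0"
    and "x \<in> S" "y \<in> S"
  shows "G x = G y"
proof -
  have "\<exists>c. \<forall>x\<in>S. G x = c"
    using assms(2,3) by (intro has_field_derivative_zero_constant[OF assms(1)])
      (metis has_field_derivative_at_within)
  with assms(4,5) show ?thesis by metis
qed

text \<open>\<open>E\<close> is a double antiderivative of a bump \<eta> of integral 1. Being zero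
  on the left and affine of slope 1 on the right makes second differences of \<open>E\<close>
  compactly supported. The bounded distance to \<open>relu\<close> makes E (n x) / n converge to it
  uniformly.\<close>

lemma smooth_relu:
  obtains E \<eta> :: "real \<Rightarrow> real"
  where "smooth E" "(deriv ^^ 2) E = \<eta>" "continuous_on UNIV \<eta>" "\<And>x. x \<notin> {0..1} \<Longrightarrow> \<eta> x = 0"
    "(LINT x|lborel. \<eta> x) = 1" "\<And>x. x \<le> 0 \<Longrightarrow> E x = 0" "\<exists>c. \<forall>x\<ge>1. E x = x - c"
    "\<exists>K. \<forall>x. \<bar>E x - relu x\<bar> \<le> K"
proof -
  let ?b = "bump 1 0"
  have cb: "continuous_on UNIV ?b"
    using smoothD[OF smooth_bump[of 1 0], of 0]
    by (auto simp: continuous_on_eq_continuous_at intro!: DERIV_isCont)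
  then obtain A where A: "A 0 = 0" "\<And>x. (A has_real_derivative ?b x) (at x)"
    using ex_antiderivative[of ?b 0] by blast
  have "0 < A 1"
  proof -
    have "A 0 < A 1"
    proof (rule DERIV_pos_imp_increasing_open[of 0 1 A])
      show "\<exists>y. (A has_real_derivative y) (at x) \<and> 0 < y" if "0 < x" "x < 1" for x
        using A(2)[of x] that by (auto simp: bump_def)
      show "continuous_on {0..1} A"
        by (rule DERIV_continuous_on[OF has_field_derivative_at_within[OF A(2)]])
    qed simp
    with A show ?thesis by simp
  qed
  define \<eta> where "\<eta> x = inverse (A 1) * ?b x" for x
  define B where "B x = inverse (A 1) * A x" for x
  have B: "(B has_real_derivative \<eta> x) (at x)" for x
    unfolding B_def \<eta>_def by (intro DERIV_cmult A)
  have "smooth \<eta>"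
    unfolding \<eta>_def by (intro smooth_cmult smooth_bump)
  then have "smooth B"
    using B by (rule smooth_antiderivative)
  have \<eta>0: "\<eta> x = 0" if "x \<notin> {0<..<1}" for x
    using that by (auto simp: \<eta>_def bump_def)
  have \<eta>0': "\<eta> x = 0" if "x \<notin> {0..1}" for x
    using that by (intro \<eta>0) auto
  have c\<eta>: "continuous_on UNIV \<eta>"
    unfolding \<eta>_def by (intro continuous_intros cb)
  have B0: "B x = 0" if "x \<le> 0" for x
    using constant_if_derivative_0[of "{..0}" B \<eta> x 0] B \<eta>0 that A(1) by (auto simp: B_def)
  have B1: "B x = 1" if "1 \<le> x" for x
    using constant_if_derivative_0[of "{1..}" B \<eta> x 1] B \<eta>0 that \<open>0 < A 1\<close> by (auto simp: B_def)
  have "continuous_on UNIV B"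
    by (rule DERIV_continuous_on[OF has_field_derivative_at_within[OF B]])
  then obtain E where E: "E 0 = 0" "\<And>x. (E has_real_derivative B x) (at x)"
    using ex_antiderivative[of B 0] by blast
  have sE: "smooth E"
    using \<open>smooth B\<close> E(2) by (rule smooth_antiderivative)
  have "deriv E = B" "deriv B = \<eta>"
    using E(2) B by (auto simp: fun_eq_iff intro!: DERIV_imp_deriv)
  then have dE: "(deriv ^^ 2) E = \<eta>"
    by (simp add: numeral_2_eq_2)
  have E0: "E x = 0" if "x \<le> 0" for x
    using constant_if_derivative_0[of "{..0}" E B x 0] E B0 that by auto
  have E1: "E x = x - (1 - E 1)" if "1 \<le> x" for x
    using constant_if_derivative_0[of "{1..}" "\<lambda>x. E x - x" "\<lambda>x. B x - 1" x 1] E B1 that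
    by (fastforce intro!: derivative_eq_intros)
  have "continuous_on {0..1} E"
    by (rule DERIV_continuous_on[OF has_field_derivative_at_within[OF E(2)]])
  then have "compact ((\<lambda>x. E x - relu x) ` {0..1})"
    by (intro compact_continuous_image continuous_intros) auto
  then have "bounded ((\<lambda>x. E x - relu x) ` {0..1})"
    by (rule compact_imp_bounded)
  then obtain K where "\<forall>x\<in>{0..1}. \<bar>E x - relu x\<bar> \<le> K"
    by (auto simp: bounded_iff)
  then have K: "\<And>x. 0 \<le> x \<Longrightarrow> x \<le> 1 \<Longrightarrow> \<bar>E x - relu x\<bar> \<le> K"
    by auto
  have K': "\<bar>E x - relu x\<bar> \<le> K" for x
  proof -
    consider "x < 0" | "0 \<le> x" "x \<le> 1" | "1 < x" by linarith
    then show ?thesis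
      using K[of 0] K[of 1] K[of x] E0[of x] E1[of x] E(1) by cases (auto simp: relu_def)
  qed
  have "(LINT x|lborel. \<eta> x * indicator {0..1} x) = B 1 - B 0"
    using B c\<eta> by (intro integral_FTC_Icc_real) (auto simp: continuous_on_eq_continuous_at)
  also have "(\<lambda>x. \<eta> x * indicator {0..1} x) = \<eta>"
  proof
    show "\<eta> x * indicator {0..1} x = \<eta> x" for x
      using \<eta>0[of x] by (cases "0 < x \<and> x < 1") auto
  qed
  finally have int: "(LINT x|lborel. \<eta> x) = 1"
    using B0[of 0] B1[of 1] by simp
  show thesis
    by (rule that[OF sE dE c\<eta> _ int E0]) (use \<eta>0' E1 K' in blast)+
qed

section \<open>Signed Radon measures\<close>

text \<open>The construction behind \<open>total_variation\<close>, for arbitrary pairs of measures: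
  it is applied below also to measures that are not mutually singular.\<close>

definition measure_sum :: "real measure \<Rightarrow> real measure \<Rightarrow> real measure" where
  "measure_sum M N = measure_of UNIV (sets borel) (\<lambda>A. emeasure M A + emeasure N A)"

lemma sets_measure_sum [simp, measurable_cong]: "sets (measure_sum M N) = sets borel"
  using sets.sigma_sets_eq[of "borel :: real measure"] by (simp add: measure_sum_def)

lemma space_measure_sum [simp]: "space (measure_sum M N) = UNIV"
  using sets_eq_imp_space_eq[OF sets_measure_sum, of M N] by simp

lemma emeasure_measure_sum:
  assumes [simp]: "sets M = sets borel" "sets N = sets borel" and "A \<in> sets borel"
  shows "emeasure (measure_sum M N) A = emeasure M A + emeasure N A"
proof -
  have "countably_additive (sets borel) (\<lambda>A. emeasure M A + emeasure N A)"
  proof (rule countably_additiveI)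
    fix B :: "nat \<Rightarrow> real set"
    assume B: "range B \<subseteq> sets borel" "disjoint_family B" "(\<Union>i. B i) \<in> sets borel"
    then show "(\<Sum>i. emeasure M (B i) + emeasure N (B i)) = emeasure M (\<Union>i. B i) + emeasure N (\<Union>i. B i)"
      by (subst suminf_add[symmetric]) (auto simp: suminf_emeasure)
  qed
  then show ?thesis
    unfolding measure_sum_def
    using assms(3) sets.sigma_algebra_axioms[of "borel :: real measure"]
    by (subst emeasure_measure_of_sigma) (auto simp: positive_def)
qed

lemma nn_integral_measure_sum:
  assumes M: "sets M = sets borel" and N: "sets N = sets borel" and g: "g \<in> borel_measurable borel"
  shows "(\<integral>\<^sup>+ x. g x \<partial>measure_sum M N) = (\<integral>\<^sup>+ x. g x \<partial>M) + (\<integral>\<^sup>+ x. g x \<partial>N)"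
proof -
  have [measurable_cong]: "sets M = sets borel" "sets N = sets borel"
    by fact+
  have [simp]: "space M = UNIV" "space N = UNIV"
    using sets_eq_imp_space_eq[OF M] sets_eq_imp_space_eq[OF N] by auto
  show ?thesis
    using g
  proof (induction rule: borel_measurable_induct)
    case (cong f g)
    then show ?case by (simp add: fun_eq_iff)
  next
    case (set A)
    then show ?case
      using M N by (simp add: emeasure_measure_sum)
  next
    case (mult u c)
    from mult(2) have [measurable]: "u \<in> borel_measurable borel" .
    show ?case
      using mult(4) by (simp add: nn_integral_cmult distrib_left)
  next
    case (add u v)
    from add have [measurable]: "u \<in> borel_measurable borel" "v \<in> borel_measurable borel" by auto
    show ?case
      using add by (simp add: nn_integral_add add_ac)
  next
    case (seq U)
    have [measurable]: "U i \<in> borel_measurable borel" for i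
      by (rule seq)
    have inc: "incseq (\<lambda>i. \<integral>\<^sup>+ x. U i x \<partial>M)" "incseq (\<lambda>i. \<integral>\<^sup>+ x. U i x \<partial>N)"
      using \<open>incseq U\<close> by (auto intro!: nn_integral_mono simp: incseq_def le_fun_def)
    have "(\<integral>\<^sup>+ x. (SUP i. U i) x \<partial>K) = (SUP i. \<integral>\<^sup>+ x. U i x \<partial>K)" if "sets K = sets borel" for K
    proof -
      have "U i \<in> borel_measurable K" for i
        using seq(1) measurable_cong_sets[OF that refl] by blast
      from nn_integral_monotone_convergence_SUP[OF \<open>incseq U\<close> this] show ?thesis
        by (simp add: image_comp)
    qed
    then show ?case
      using M N seq.IH by (simp add: ennreal_SUP_add[OF inc])
  qed
qed

lemma total_variation_eq: "total_variation \<mu> = measure_sum (positive_variation \<mu>) (negative_variation \<mu>)"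
  by (simp add: total_variation_def measure_sum_def)

lemma nn_integral_total_variation:
  assumes "g \<in> borel_measurable borel"
  shows "(\<integral>\<^sup>+ x. g x \<partial>total_variation \<mu>) =
    (\<integral>\<^sup>+ x. g x \<partial>positive_variation \<mu>) + (\<integral>\<^sup>+ x. g x \<partial>negative_variation \<mu>)"
  using assms by (simp add: total_variation_eq nn_integral_measure_sum)

lemma radon_variation: "radon (positive_variation \<mu>)" "radon (negative_variation \<mu>)"
    and singular_variation: "mutually_singular (positive_variation \<mu>) (negative_variation \<mu>)"
  using Rep_signed_radon[of \<mu>] by (auto simp: positive_variation_def negative_variation_def)

declare sets_variation [measurable_cong] sets_total_variation [measurable_cong]

lemma radon_integrable:
  fixes g :: "real \<Rightarrow> real"
  assumes M: "radon M" and "g \<in> borel_measurable borel"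
    and "\<And>x. \<bar>g x\<bar> \<le> B" "\<And>x. R < \<bar>x\<bar> \<Longrightarrow> g x = 0"
  shows "integrable M g"
proof (rule integrableI_bounded_set[of "{-R..R}"])
  have s: "sets M = sets borel"
    using M by (simp add: radon_def)
  show "{-R..R} \<in> sets M" by (simp add: s)
  show "g \<in> borel_measurable M"
    using assms(2) by (simp add: measurable_cong_sets[OF s refl])
  show "emeasure M {-R..R} < \<infinity>"
    using M by (simp add: radon_def)
  show "AE x in M. x \<in> {- R..R} \<longrightarrow> norm (g x) \<le> B"
    using assms(3) by simp
  show "AE x in M. x \<notin> {- R..R} \<longrightarrow> g x = 0"
    using assms(4) by (intro AE_I2 impI) auto
qed

lemma continuous_compact_support_bounded:
  fixes g :: "real \<Rightarrow> real"
  assumes "continuous_on UNIV g" "\<And>x. R < \<bar>x\<bar> \<Longrightarrow> g x = 0"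
  obtains B where "0 \<le> B" "\<And>x. \<bar>g x\<bar> \<le> B"
proof -
  have "compact (g ` {-R..R})"
    by (intro compact_continuous_image continuous_on_subset[OF assms(1)]) auto
  then have "bounded (g ` {-R..R})"
    by (rule compact_imp_bounded)
  then obtain B where B: "\<forall>x\<in>{-R..R}. \<bar>g x\<bar> \<le> B"
    by (auto simp: bounded_iff)
  show thesis
  proof (rule that[of "max 0 B"])
    show "\<bar>g x\<bar> \<le> max 0 B" for x
    proof (cases "R < \<bar>x\<bar>")
      case False
      then have "x \<in> {-R..R}" by auto
      with B show ?thesis by (auto simp: max_def)
    qed (simp add: assms(2))
  qed simp
qed

lemma radon_integrable_continuous:
  fixes g :: "real \<Rightarrow> real"
  assumes "radon M" "continuous_on UNIV g" "\<And>x. R < \<bar>x\<bar> \<Longrightarrow> g x = 0"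
  shows "integrable M g"
proof -
  obtain B where "\<And>x. \<bar>g x\<bar> \<le> B"
    using continuous_compact_support_bounded[OF assms(2,3)] by blast
  then show ?thesis
    by (rule radon_integrable[OF assms(1) borel_measurable_continuous_onI[OF assms(2)] _ assms(3)])
qed

lemma radon_integral_tendsto:
  fixes g :: "nat \<Rightarrow> real \<Rightarrow> real"
  assumes M: "radon M" and g: "\<And>n. g n \<in> borel_measurable borel" "f \<in> borel_measurable borel"
    and "\<And>n x. \<bar>g n x\<bar> \<le> B" "\<And>n x. R < \<bar>x\<bar> \<Longrightarrow> g n x = 0" "\<And>x. (\<lambda>n. g n x) \<longlonglongrightarrow> f x"
  shows "(\<lambda>n. LINT x|M. g n x) \<longlonglongrightarrow> (LINT x|M. f x)"
proof (rule integral_dominated_convergence[where w = "\<lambda>x. B * indicator {-R..R} x"])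
  have s: "sets M = sets borel"
    using M by (simp add: radon_def)
  show "f \<in> borel_measurable M" "\<And>n. g n \<in> borel_measurable M"
    using g by (simp_all add: measurable_cong_sets[OF s refl])
  show "integrable M (\<lambda>x. B * indicator {- R..R} x)"
    by (rule radon_integrable[OF M, where B = "\<bar>B\<bar>" and R = R]) (auto simp: indicator_def)
  show "AE x in M. norm (g n x) \<le> B * indicator {- R..R} x" for n
    using assms(4,5) by (intro AE_I2) (force simp: indicator_def)
qed (use assms(6) in auto)

lemma signed_integral_tendsto:
  fixes g :: "nat \<Rightarrow> real \<Rightarrow> real"
  assumes "\<And>n. g n \<in> borel_measurable borel" "f \<in> borel_measurable borel"
    and "\<And>n x. \<bar>g n x\<bar> \<le> B" "\<And>n x. R < \<bar>x\<bar> \<Longrightarrow> g n x = 0" "\<And>x. (\<lambda>n. g n x) \<longlonglongrightarrow> f x"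
  shows "(\<lambda>n. signed_integral \<mu> (g n)) \<longlonglongrightarrow> signed_integral \<mu> f"
  unfolding signed_integral_def
  by (intro tendsto_diff radon_integral_tendsto[of _ g, OF _ assms] radon_variation)

section \<open>Second differences as integrals of hat functions\<close>

lemma deriv2_eq:
  assumes "\<And>x. (f has_real_derivative g x) (at x)" "\<And>x. (g has_real_derivative k x) (at x)"
  shows "(deriv ^^ 2) f = k"
proof -
  have "deriv f = g" "deriv g = k"
    using assms by (auto intro!: ext DERIV_imp_deriv)
  then show ?thesis
    by (simp add: numeral_2_eq_2)
qed

text \<open>The substitution y = (n + 1) (x - s) fixes the kernel \<eta> and moves the dependence on
  n into f (s + y / (n + 1)). Since \<eta> lives on [0, 1], only values of \<open>f\<close> on
  [s, s + 1] occur, and dominated convergence applies.\<close>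

lemma mollifier_tendsto:
  fixes f \<eta> :: "real \<Rightarrow> real"
  assumes f: "continuous_on UNIV f" and \<eta>: "continuous_on UNIV \<eta>" "\<And>x. x \<notin> {0..1} \<Longrightarrow> \<eta> x = 0"
    "(LINT x|lborel. \<eta> x) = 1"
  shows "integrable lborel (\<lambda>x. f x * (real (Suc n) * \<eta> (real (Suc n) * (x - s))))"
    and "(\<lambda>n. LINT x|lborel. f x * (real (Suc n) * \<eta> (real (Suc n) * (x - s)))) \<longlonglongrightarrow> f s"
proof -
  have lb: "radon lborel"
    by (simp add: radon_def emeasure_bounded_finite compact_imp_bounded del: infinity_ennreal_def)
  note [measurable] = borel_measurable_continuous_onI[OF f] borel_measurable_continuous_onI[OF \<eta>(1)]
  have \<eta>0: "\<eta> (real (Suc n) * (x - s)) = 0" if "\<bar>s\<bar> + 1 < \<bar>x\<bar>" for n x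
  proof -
    have "x - s < 0 \<or> 1 < x - s"
      using that by (auto simp: abs_if split: if_splits)
    then show ?thesis
    proof
      assume "x - s < 0"
      then have "real (Suc n) * (x - s) < 0"
        by (intro mult_pos_neg) auto
      then show ?thesis by (intro \<eta>(2)) auto
    next
      assume *: "1 < x - s"
      have "1 * 1 < real (Suc n) * (x - s)"
        by (rule mult_le_less_imp_less) (use * in auto)
      then show ?thesis by (intro \<eta>(2)) auto
    qed
  qed
  show "integrable lborel (\<lambda>x. f x * (real (Suc n) * \<eta> (real (Suc n) * (x - s))))"
  proof (rule radon_integrable_continuous[OF lb])
    show "continuous_on UNIV (\<lambda>x. f x * (real (Suc n) * \<eta> (real (Suc n) * (x - s))))"
      by (intro continuous_intros f continuous_on_compose2[OF \<eta>(1)]) auto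
  qed (use \<eta>0 in auto)
  have "(LINT x|lborel. f x * (real (Suc n) * \<eta> (real (Suc n) * (x - s)))) =
      (LINT y|lborel. f (s + y / real (Suc n)) * \<eta> y)" for n
    by (subst lborel_integral_real_affine[where c = "1 / real (Suc n)" and t = s])
      (auto simp: mult.left_commute[of _ "real (Suc n)"] simp del: of_nat_Suc)
  moreover have "(\<lambda>n. LINT y|lborel. f (s + y / real (Suc n)) * \<eta> y) \<longlonglongrightarrow> (LINT y|lborel. f s * \<eta> y)"
  proof -
    have "compact (f ` {s..s + 1})"
      by (intro compact_continuous_image continuous_on_subset[OF f]) auto
    then have "bounded (f ` {s..s + 1})"
      by (rule compact_imp_bounded)
    then obtain B where B: "\<forall>x\<in>{s..s + 1}. \<bar>f x\<bar> \<le> B"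
      by (auto simp: bounded_iff)
    obtain C where C: "0 \<le> C" "\<And>x. \<bar>\<eta> x\<bar> \<le> C"
      using continuous_compact_support_bounded[OF \<eta>(1), of 1] \<eta>(2) by (metis atLeastAtMost_iff abs_of_nonneg not_le)
    show ?thesis
    proof (rule radon_integral_tendsto[OF lb, where B = "\<bar>B\<bar> * C" and R = 1])
      show "\<bar>f (s + y / real (Suc n)) * \<eta> y\<bar> \<le> \<bar>B\<bar> * C" for n y
      proof (cases "y \<in> {0..1}")
        case True
        then have "y / real (Suc n) \<le> 1 / 1"
          by (intro frac_le) auto
        with True have "\<bar>f (s + y / real (Suc n))\<bar> \<le> \<bar>B\<bar>"
          by (intro order_trans[OF B[rule_format]]) (auto simp del: of_nat_Suc)
        then show ?thesis
          unfolding abs_mult using C by (intro mult_mono) auto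
      next
        case False
        then show ?thesis
          using C(1) \<eta>(2)[of y] by simp
      qed
      show "(\<lambda>n. f (s + y / real (Suc n)) * \<eta> y) \<longlonglongrightarrow> f s * \<eta> y" for y
      proof -
        have "(\<lambda>n. s + y / real (Suc n)) \<longlonglongrightarrow> s + 0"
          by (intro tendsto_add tendsto_const LIMSEQ_Suc[OF lim_const_over_n])
        then have "(\<lambda>n. f (s + y / real (Suc n))) \<longlonglongrightarrow> f s"
          using f by (auto intro!: isCont_tendsto_compose[of s f] simp: continuous_on_eq_continuous_at)
        then show ?thesis by (intro tendsto_mult tendsto_const)
      qed
      show "f (s + y / real (Suc n)) * \<eta> y = 0" if "1 < \<bar>y\<bar>" for n y
        using that \<eta>(2)[of y] by (cases "y \<in> {0..1}") auto
    qed auto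
  qed
  ultimately show "(\<lambda>n. LINT x|lborel. f x * (real (Suc n) * \<eta> (real (Suc n) * (x - s)))) \<longlonglongrightarrow> f s"
    using \<eta>(3) by simp
qed

text \<open>Replacing each ReLU in the hat by a rescaled copy of \<open>E\<close> gives a genuine
  test function. Its second derivative is the second difference of mollifiers placed at t - h, t and
  t + h, so the distributional identity becomes a second difference of mollified values of
  \<open>f\<close>, and both sides pass to the limit.\<close>

lemma signed_integral_hat:
  assumes f: "continuous_on UNIV f" and \<mu>: "is_deriv2_measure f \<mu>" and h: "0 < h"
  shows "signed_integral \<mu> (hat h t) = second_diff h f t"
proof -
  obtain E \<eta> :: "real \<Rightarrow> real" where
    E: "smooth E" "(deriv ^^ 2) E = \<eta>" and \<eta>: "continuous_on UNIV \<eta>" "\<And>x. x \<notin> {0..1} \<Longrightarrow> \<eta> x = 0"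
    "(LINT x|lborel. \<eta> x) = 1" and E0: "\<And>x. x \<le> 0 \<Longrightarrow> E x = 0" and E1': "\<exists>c. \<forall>x\<ge>1. E x = x - c"
    and K': "\<exists>K. \<forall>x. \<bar>E x - relu x\<bar> \<le> K"
    by (rule smooth_relu) blast
  from E1' obtain c where E1: "\<And>x. 1 \<le> x \<Longrightarrow> E x = x - c" by blast
  from K' obtain K where K: "\<And>x. \<bar>E x - relu x\<bar> \<le> K" by blast
  define A where "A n s x = 1 / real (Suc n) * E (real (Suc n) * (x - s))" for n s x
  define \<phi> where "\<phi> n x = 1 / h * (A n (t - h) x + (- 2 * A n t x + A n (t + h) x))" for n x
  have A0: "A n s x = 0" if "x \<le> s" for n s x
    using that by (simp add: A_def E0 mult_nonneg_nonpos)
  have A1: "A n s x = x - s - c / real (Suc n)" if "s + 1 \<le> x" for n s x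
  proof -
    have "1 * 1 \<le> real (Suc n) * (x - s)"
      using that by (intro mult_mono) auto
    then show ?thesis
      by (simp add: A_def E1 field_simps del: of_nat_Suc)
  qed
  have AK: "\<bar>A n s x - relu (x - s)\<bar> \<le> K / real (Suc n)" for n s x
  proof -
    have "relu (x - s) = 1 / real (Suc n) * relu (real (Suc n) * (x - s))"
      by (auto simp: relu_def max_def zero_le_mult_iff simp del: of_nat_Suc)
    then have "\<bar>A n s x - relu (x - s)\<bar> =
        1 / real (Suc n) * \<bar>E (real (Suc n) * (x - s)) - relu (real (Suc n) * (x - s))\<bar>"
      by (simp add: A_def del: of_nat_Suc flip: diff_divide_distrib)
    also have "\<dots> \<le> 1 / real (Suc n) * K"
      by (intro mult_left_mono K) auto
    finally show ?thesis by simp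
  qed
  have smA: "smooth (A n s)" for n s
  proof -
    have "A n s = (\<lambda>x. 1 / real (Suc n) * E (real (Suc n) * x + - (real (Suc n) * s)))"
      by (simp add: A_def fun_eq_iff right_diff_distrib)
    then show ?thesis
      by (simp only: smooth_cmult[OF smooth_affine[OF E(1)]])
  qed
  have sm: "smooth (\<phi> n)" for n
    using smooth_cmult[OF smooth_add[OF smA smooth_add[OF smooth_cmult[OF smA] smA]]]
    by (simp only: \<phi>_def[abs_def])
  define R where "R = \<bar>t\<bar> + h + 1"
  \<comment> \<open>Right of t + h + 1 all three copies are on their affine branch, where the second
    difference cancels; left of t - h all of them vanish.\<close>
  have \<phi>0: "\<phi> n x = 0" if "R \<le> \<bar>x\<bar>" for n x
  proof -
    have "x \<le> t - h \<or> t + h + 1 \<le> x"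
      using that h unfolding R_def by (auto simp: abs_if split: if_splits)
    then show ?thesis
    proof
      assume "x \<le> t - h"
      with h show ?thesis by (simp add: \<phi>_def A0)
    next
      assume "t + h + 1 \<le> x"
      with h show ?thesis by (simp add: \<phi>_def A1)
    qed
  qed
  then have "test_function (\<phi> n)" for n
    using sm by (auto simp: test_function_iff)
  with \<mu> have eq: "distr_deriv2 f (\<phi> n) = signed_integral \<mu> (\<phi> n)" for n
    by (simp add: is_deriv2_measure_def)
  define I where "I n s = (LINT x|lborel. f x * (real (Suc n) * \<eta> (real (Suc n) * (x - s))))" for n s
  have dA: "(A n s has_real_derivative deriv E (real (Suc n) * (x - s))) (at x)" for n s x
  proof -
    have "((\<lambda>x. E (real (Suc n) * (x - s))) has_real_derivative
        deriv E (real (Suc n) * (x - s)) * real (Suc n)) (at x)"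
      using smoothD[OF E(1), of 0] by (intro DERIV_chain2[of E]) (auto intro!: derivative_eq_intros)
    from DERIV_cmult[OF this, of "1 / real (Suc n)"] show ?thesis
      by (simp add: A_def[abs_def] del: of_nat_Suc)
  qed
  have ddA: "((\<lambda>x. deriv E (real (Suc n) * (x - s))) has_real_derivative
      real (Suc n) * \<eta> (real (Suc n) * (x - s))) (at x)" for n s x
  proof -
    have "(deriv E has_real_derivative \<eta> y) (at y)" for y
      using smoothD[OF E(1), of 1] E(2) by (simp add: numeral_2_eq_2)
    then have "((\<lambda>x. deriv E (real (Suc n) * (x - s))) has_real_derivative
      \<eta> (real (Suc n) * (x - s)) * real (Suc n)) (at x)"
      by (rule DERIV_chain2) (auto intro!: derivative_eq_intros)
    then show ?thesis by (simp add: mult.commute)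
  qed
  have int: "integrable lborel (\<lambda>x. f x * (real (Suc n) * \<eta> (real (Suc n) * (x - s))))" for n s
    by (rule mollifier_tendsto(1); fact)
  have lim: "(\<lambda>n. I n s) \<longlonglongrightarrow> f s" for s
    unfolding I_def by (rule mollifier_tendsto(2); fact)
  have "distr_deriv2 f (\<phi> n) = second_diff h (I n) t" for n
  proof -
    let ?e = "\<lambda>s x. real (Suc n) * \<eta> (real (Suc n) * (x - s))"
    have "(deriv ^^ 2) (\<phi> n) = (\<lambda>x. 1 / h * (?e (t - h) x + (- 2 * ?e t x + ?e (t + h) x)))"
      unfolding \<phi>_def[abs_def]
      by (rule deriv2_eq[where g = "\<lambda>x. 1 / h * (deriv E (real (Suc n) * (x - (t - h)))
            + (- 2 * deriv E (real (Suc n) * (x - t)) + deriv E (real (Suc n) * (x - (t + h)))))"])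
        (intro DERIV_cmult DERIV_add dA ddA)+
    then have "distr_deriv2 f (\<phi> n) =
        (LINT x|lborel. 1 / h * (f x * ?e (t - h) x + (- 2 * (f x * ?e t x) + f x * ?e (t + h) x)))"
      unfolding distr_deriv2_def by (intro Bochner_Integration.integral_cong) (simp_all only: algebra_simps)
    also have "\<dots> = 1 / h * (I n (t - h) + (- 2 * I n t + I n (t + h)))"
      unfolding I_def using int
      by (simp only: Bochner_Integration.integral_mult_right_zero Bochner_Integration.integral_add
          Bochner_Integration.integrable_add Bochner_Integration.integrable_mult_right)
    finally show ?thesis
      using h by (simp add: second_diff_def field_simps)
  qed
  then have "signed_integral \<mu> (\<phi> n) = second_diff h (I n) t" for n
    by (simp only: eq)
  moreover have "(\<lambda>n. second_diff h (I n) t) \<longlonglongrightarrow> second_diff h f t"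
    unfolding second_diff_def
    using h by (intro tendsto_intros lim) auto
  moreover have "(\<lambda>n. signed_integral \<mu> (\<phi> n)) \<longlonglongrightarrow> signed_integral \<mu> (hat h t)"
  proof (rule signed_integral_tendsto[where R = R and B = "1 + 4 * \<bar>K\<bar> / h"])
    \<comment> \<open>The coefficients 1, - 2, 1 have absolute sum 4, and every copy of
      \<open>E\<close> is within K / (n + 1) of its ReLU. The case n = 0 gives the uniform bound
      used for dominated convergence.\<close>
    have close: "\<bar>\<phi> n x - hat h t x\<bar> \<le> 4 * \<bar>K\<bar> / h / real (Suc n)" for n x
    proof -
      have "\<bar>A n (t - h) x + (- 2 * A n t x + A n (t + h) x)
          - (relu (x - (t - h)) + (- 2 * relu (x - t) + relu (x - (t + h))))\<bar> \<le> 4 * (K / real (Suc n))"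
        using AK[of n "t - h" x] AK[of n t x] AK[of n "t + h" x] by linarith
      also have "\<dots> \<le> 4 * \<bar>K\<bar> / real (Suc n)"
        by (simp add: divide_right_mono)
      finally have "\<bar>A n (t - h) x + (- 2 * A n t x + A n (t + h) x)
          - (relu (x - (t - h)) + (- 2 * relu (x - t) + relu (x - (t + h))))\<bar> / h \<le> 4 * \<bar>K\<bar> / real (Suc n) / h"
        using h by (intro divide_right_mono) auto
      moreover have "\<phi> n x - hat h t x = (A n (t - h) x + (- 2 * A n t x + A n (t + h) x)
          - (relu (x - (t - h)) + (- 2 * relu (x - t) + relu (x - (t + h))))) / h"
        using h by (simp add: \<phi>_def hat_def field_simps)
      ultimately show ?thesis
        using h by (simp add: mult.commute abs_divide)
    qed
    show "\<phi> n \<in> borel_measurable borel" for n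
      using smoothD[OF sm[of n], of 0]
      by (auto intro!: borel_measurable_continuous_onI DERIV_isCont simp: continuous_on_eq_continuous_at)
    show "\<bar>\<phi> n x\<bar> \<le> 1 + 4 * \<bar>K\<bar> / h" for n x
    proof -
      have "4 * \<bar>K\<bar> / h / real (Suc n) \<le> 4 * \<bar>K\<bar> / h / 1"
        using h by (intro divide_left_mono) auto
      then show ?thesis
        using close[of n x] hat_nonneg[OF h, of t x] hat_le_1[OF h, of t x] by linarith
    qed
    show "\<phi> n x = 0" if "R < \<bar>x\<bar>" for n x
      using that by (intro \<phi>0) simp
    show "(\<lambda>n. \<phi> n x) \<longlonglongrightarrow> hat h t x" for x
    proof -
      have "(\<lambda>n. \<phi> n x - hat h t x) \<longlonglongrightarrow> 0"
      proof (rule Lim_null_comparison)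
        show "\<forall>\<^sub>F n in sequentially. norm (\<phi> n x - hat h t x) \<le> 4 * \<bar>K\<bar> / h / real (Suc n)"
          using close by (intro always_eventually allI) (simp only: real_norm_def)
        show "(\<lambda>n. 4 * \<bar>K\<bar> / h / real (Suc n)) \<longlonglongrightarrow> 0"
          by (rule LIMSEQ_Suc[OF lim_const_over_n])
      qed
      then show ?thesis by (simp add: LIM_zero_iff)
    qed
  qed simp
  ultimately show ?thesis
    by (simp add: LIMSEQ_unique)
qed

lemma integrable_hat:
  assumes "radon M" "0 < h"
  shows "integrable M (hat h t)"
proof (rule radon_integrable_continuous[OF assms(1) continuous_on_hat])
  show "hat h t x = 0" if "\<bar>t\<bar> + h < \<bar>x\<bar>" for x
    using that by (intro hat_eq_0 assms(2)) linarith
qed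

lemma signed_integral_sum_hat:
  assumes "0 < h"
  shows "signed_integral \<mu> (\<lambda>x. \<Sum>k\<in>A. u k * hat h (s k) x) = (\<Sum>k\<in>A. u k * signed_integral \<mu> (hat h (s k)))"
  using integrable_hat[OF radon_variation(1) assms] integrable_hat[OF radon_variation(2) assms]
  by (simp add: signed_integral_def sum_subtractf right_diff_distrib)

section \<open>Networks from second derivatives\<close>

text \<open>The first chord slope plus the slope jumps at the nodes 1 to m is the slope of the chord
  over cell m, so the accumulated affine pieces form that chord.\<close>

lemma partial_interpolation:
  assumes "h \<noteq> 0"
  shows "f t + (f (t + h) - f t) / h * (x - t) + (\<Sum>k = 1..m. second_diff h f (t + real k * h) * (x - (t + real k * h)))
    = f (t + real m * h) + (f (t + real (Suc m) * h) - f (t + real m * h)) / h * (x - (t + real m * h))"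
proof (induction m)
  case (Suc m)
  have e: "t + real (Suc m) * h + h = t + real (Suc (Suc m)) * h" "t + real (Suc m) * h - h = t + real m * h"
    by (simp_all add: algebra_simps)
  define p q r y where "p = f (t + real m * h)" and "q = f (t + real (Suc m) * h)"
    and "r = f (t + real (Suc (Suc m)) * h)" and "y = x - (t + real (Suc m) * h)"
  have xm: "x - (t + real m * h) = y + h"
    by (simp add: y_def algebra_simps)
  let ?G = "\<lambda>k. second_diff h f (t + real k * h) * (x - (t + real k * h))"
  have last: "?G (Suc m) = (r - 2 * q + p) / h * y"
    by (simp only: second_diff_def e p_def q_def r_def y_def)
  have IH: "f t + (f (t + h) - f t) / h * (x - t) + (\<Sum>k = 1..m. ?G k) = p + (q - p) / h * (y + h)"
    using Suc by (simp only: xm p_def q_def)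
  have "f t + (f (t + h) - f t) / h * (x - t) + (\<Sum>k = 1..Suc m. ?G k)
      = (f t + (f (t + h) - f t) / h * (x - t) + (\<Sum>k = 1..m. ?G k)) + ?G (Suc m)"
    by simp
  also have "\<dots> = p + (q - p) / h * (y + h) + (r - 2 * q + p) / h * y"
    by (simp only: IH last)
  also have "\<dots> = q + (r - q) / h * y"
    using assms by (simp add: field_simps)
  finally show ?case
    by (simp only: p_def q_def r_def y_def)
qed simp

text \<open>One L h bounds the change of \<open>f\<close> from the left node of the cell to x, the
  other the rise of the chord, whose slope is at most L.\<close>

lemma interpolation_error:
  fixes f :: "real \<Rightarrow> real"
  assumes f: "L-lipschitz_on UNIV f" and h: "0 < h" and x: "t \<le> x" "x \<le> t + real (Suc n) * h"
  shows "\<bar>f t + (f (t + h) - f t) / h * (x - t)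
      + (\<Sum>k = 1..n. second_diff h f (t + real k * h) * relu (x - (t + real k * h))) - f x\<bar> \<le> 2 * L * h"
proof -
  have L: "\<bar>f x - f y\<bar> \<le> L * \<bar>x - y\<bar>" for x y
    using lipschitz_onD[OF f, of x y] by (simp add: dist_real_def)
  \<comment> \<open>The cell of x. Since n kinks separate n + 1 cells, x may lie up to t + (n + 1)
    h.\<close>
  obtain m where m: "m \<le> n" "t + real m * h \<le> x" "x \<le> t + real (Suc m) * h"
  proof -
    define m where "m = (LEAST m. x \<le> t + real (Suc m) * h)"
    have 1: "x \<le> t + real (Suc m) * h" and 2: "m \<le> n"
      unfolding m_def using x by (auto intro: LeastI Least_le)
    have 3: "t + real m * h \<le> x"
    proof (cases m)
      case (Suc m')
      then have "\<not> x \<le> t + real (Suc m') * h"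
        unfolding m_def using not_less_Least[of m' "\<lambda>m. x \<le> t + real (Suc m) * h"] by linarith
      with Suc show ?thesis by simp
    qed (use x in simp)
    show thesis by (rule that[OF 2 3 1])
  qed
  \<comment> \<open>At x the kinks to the right of the cell are inactive and those up to its left
    end are linear.\<close>
  have "(\<Sum>k = 1..n. second_diff h f (t + real k * h) * relu (x - (t + real k * h))) =
      (\<Sum>k = 1..m. second_diff h f (t + real k * h) * (x - (t + real k * h)))"
  proof (rule sum.mono_neutral_cong_right)
    show "\<forall>k\<in>{1..n} - {1..m}. second_diff h f (t + real k * h) * relu (x - (t + real k * h)) = 0"
    proof
      fix k assume "k \<in> {1..n} - {1..m}"
      then have "real (Suc m) * h \<le> real k * h"
        using h by (intro mult_right_mono) auto
      with m(3) show "second_diff h f (t + real k * h) * relu (x - (t + real k * h)) = 0"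
        by (simp add: relu_def)
    qed
    fix k assume "k \<in> {1..m}"
    then have "real k * h \<le> real m * h"
      using h by (intro mult_right_mono) auto
    with m(2) show "second_diff h f (t + real k * h) * relu (x - (t + real k * h)) =
        second_diff h f (t + real k * h) * (x - (t + real k * h))"
      by (simp add: relu_def)
  qed (use m in auto)
  with partial_interpolation[of h f t x m] h
  have "\<bar>f t + (f (t + h) - f t) / h * (x - t)
      + (\<Sum>k = 1..n. second_diff h f (t + real k * h) * relu (x - (t + real k * h))) - f x\<bar>
      = \<bar>(f (t + real m * h) - f x) + (f (t + real (Suc m) * h) - f (t + real m * h)) / h * (x - (t + real m * h))\<bar>"
    by (simp del: of_nat_Suc)
  also have "\<dots> \<le> \<bar>f (t + real m * h) - f x\<bar> + \<bar>(f (t + real (Suc m) * h) - f (t + real m * h)) / h * (x - (t + real m * h))\<bar>"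
    by (rule abs_triangle_ineq)
  also have "\<bar>f (t + real m * h) - f x\<bar> \<le> L * h"
  proof -
    have "\<bar>t + real m * h - x\<bar> \<le> h"
      using m by (simp add: algebra_simps)
    then show ?thesis
      using L[of "t + real m * h" x] lipschitz_on_nonneg[OF f]
      by (meson mult_left_mono order_trans)
  qed
  also have "\<bar>(f (t + real (Suc m) * h) - f (t + real m * h)) / h * (x - (t + real m * h))\<bar> \<le> L * h"
    unfolding abs_mult
  proof (rule mult_mono)
    have "\<bar>f (t + real (Suc m) * h) - f (t + real m * h)\<bar> \<le> L * h"
      using L[of "t + real (Suc m) * h" "t + real m * h"] h by (simp add: algebra_simps)
    then show "\<bar>(f (t + real (Suc m) * h) - f (t + real m * h)) / h\<bar> \<le> L"
      using h by (simp add: abs_divide pos_divide_le_eq)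
    show "\<bar>x - (t + real m * h)\<bar> \<le> h"
      using m by (simp add: algebra_simps)
  qed (use lipschitz_on_nonneg[OF f] in auto)
  finally show ?thesis by simp
qed

text \<open>Balancing inner and outer weights makes the AM-GM bound on the cost of a neuron sharp.\<close>

lemma ex_network_params:
  obtains a w b where "\<And>x. (\<Sum>k = 1..n. a k * relu (w k * x + b k)) = (\<Sum>k = 1..n. c k * relu (x - s k))"
    "1 / 2 * param_norm_sq n a w b = (\<Sum>k = 1..n. \<bar>c k\<bar> * weight (s k))"
proof
  \<comment> \<open>With bias - w s, the squares of w and of the bias add up to the square of w *
    weight s. Equality in AM-GM requires \<bar>a\<bar> = w * weight s, which together with a w = c
    determines w and a.\<close>
  let ?w = "\<lambda>k. sqrt (\<bar>c k\<bar> / weight (s k))"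
  let ?a = "\<lambda>k. sgn (c k) * sqrt (\<bar>c k\<bar> * weight (s k))"
  have W: "0 < weight (s k)" for k
    by (rule weight_pos)
  have aw: "?a k * ?w k = c k" for k
  proof -
    have "sqrt (\<bar>c k\<bar> * weight (s k)) * ?w k = sqrt (\<bar>c k\<bar> * \<bar>c k\<bar>)"
      using W[of k] unfolding real_sqrt_mult[symmetric] by (simp add: field_simps)
    then show ?thesis
      by (simp add: mult.assoc sgn_mult_abs)
  qed
  have scale: "relu (v * x + - v * y) = v * relu (x - y)" if "0 \<le> v" for v x y
    using max_mult_distrib_left[of v 0 "x - y"] that by (simp add: relu_def right_diff_distrib)
  have "?a k * relu (?w k * x + - ?w k * s k) = c k * relu (x - s k)" for k x
  proof -
    have "relu (?w k * x + - ?w k * s k) = ?w k * relu (x - s k)"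
      by (rule scale) (simp add: W less_imp_le)
    with aw[of k] show ?thesis by (metis mult.assoc)
  qed
  then show "(\<Sum>k = 1..n. ?a k * relu (?w k * x + - ?w k * s k)) = (\<Sum>k = 1..n. c k * relu (x - s k))" for x
    by simp
  have "(?a k)\<^sup>2 + (?w k)\<^sup>2 + (- ?w k * s k)\<^sup>2 = 2 * (\<bar>c k\<bar> * weight (s k))" for k
  proof -
    have "(sgn (c k))\<^sup>2 * (\<bar>c k\<bar> * weight (s k)) = \<bar>c k\<bar> * weight (s k)"
      by (cases "c k = 0") (auto simp: sgn_if)
    then have a: "(?a k)\<^sup>2 = \<bar>c k\<bar> * weight (s k)"
      using W[of k] by (simp add: power_mult_distrib)
    have "(?w k)\<^sup>2 + (- ?w k * s k)\<^sup>2 = \<bar>c k\<bar> / weight (s k) * (1 + (s k)\<^sup>2)"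
      using W[of k] by (simp add: power_mult_distrib algebra_simps)
    also have "1 + (s k)\<^sup>2 = weight (s k) * weight (s k)"
      by (simp add: weight_def)
    finally show ?thesis
      using a W[of k] by simp
  qed
  then show "1 / 2 * param_norm_sq n ?a ?w (\<lambda>k. - ?w k * s k) = (\<Sum>k = 1..n. \<bar>c k\<bar> * weight (s k))"
    by (simp add: param_norm_sq_def sum_distrib_left[symmetric])
qed

lemma abs_signed_integral_hat_le:
  assumes h: "0 < h"
  shows "ennreal \<bar>signed_integral \<mu> (hat h t)\<bar> \<le> (\<integral>\<^sup>+ x. ennreal (hat h t x) \<partial>total_variation \<mu>)"
proof -
  let ?P = "positive_variation \<mu>" and ?N = "negative_variation \<mu>"
  have eq: "(\<integral>\<^sup>+ x. ennreal (hat h t x) \<partial>M) = ennreal (LINT x|M. hat h t x)" if "radon M" for M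
    using integrable_hat[OF that h] hat_nonneg[OF h] by (intro nn_integral_eq_integral) auto
  have nn: "0 \<le> (LINT x|M. hat h t x)" for M
    using hat_nonneg[OF h] by (intro integral_nonneg_AE) auto
  have "\<bar>signed_integral \<mu> (hat h t)\<bar> \<le> (LINT x|?P. hat h t x) + (LINT x|?N. hat h t x)"
    unfolding signed_integral_def using nn[of ?P] nn[of ?N] by linarith
  then have "ennreal \<bar>signed_integral \<mu> (hat h t)\<bar> \<le> ennreal ((LINT x|?P. hat h t x) + (LINT x|?N. hat h t x))"
    by (rule ennreal_leI)
  also have "\<dots> = (\<integral>\<^sup>+ x. ennreal (hat h t x) \<partial>total_variation \<mu>)"
    by (subst nn_integral_total_variation) (simp_all add: eq radon_variation nn)
  finally show ?thesis .
qed

text \<open>The cost of the interpolant is the sum of weight times \<bar>slope jump\<bar>, and each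
  jump is the integral of a hat against \<mu>. Summing under the integral leaves the interpolated
  weight. Any sufficiently small mesh meets the precision \<epsilon>, so the factor 1 + h can be
  removed without changing \<epsilon>.\<close>

lemma approx_cost_le_weighted_tv:
  assumes f: "L-lipschitz_on UNIV f" and \<mu>: "is_deriv2_measure f \<mu>" and \<epsilon>: "0 < \<epsilon>"
  shows "approx_cost f \<epsilon> \<le> (\<integral>\<^sup>+ x. ennreal (weight x) \<partial>total_variation \<mu>)" (is "_ \<le> ?W")
proof -
  have cf: "continuous_on UNIV f"
    using f by (rule lipschitz_on_continuous_on)
  have L: "0 \<le> L"
    using f by (rule lipschitz_on_nonneg)
  have *: "approx_cost f \<epsilon> \<le> ennreal (1 + h) * ?W" if h: "0 < h" "2 * L * h \<le> \<epsilon>" for h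
  proof -
    define t where "t = - 1 / \<epsilon>"
    \<comment> \<open>Enough nodes for the grid starting at - 1 / \<epsilon> to cover an interval of
      length 2 / \<epsilon>.\<close>
    obtain n where n: "2 / \<epsilon> / h \<le> real n"
      using real_arch_simple by blast
    let ?s = "\<lambda>k. t + real k * h"
    let ?c = "\<lambda>k. second_diff h f (?s k)"
    obtain a w b where ab: "\<And>x. (\<Sum>k = 1..n. a k * relu (w k * x + b k)) = (\<Sum>k = 1..n. ?c k * relu (x - ?s k))"
      and norm: "1 / 2 * param_norm_sq n a w b = (\<Sum>k = 1..n. \<bar>?c k\<bar> * weight (?s k))"
      using ex_network_params[of n ?c ?s] by blast
    \<comment> \<open>The skip connection carries the first chord at no cost.\<close>
    let ?m = "(f (t + h) - f t) / h"
    have net: "network n a w b ?m (f t - ?m * t) x =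
        f t + ?m * (x - t) + (\<Sum>k = 1..n. ?c k * relu (x - ?s k))" for x
      unfolding network_def ab by (simp add: right_diff_distrib)
    have "\<bar>network n a w b ?m (f t - ?m * t) x - f x\<bar> \<le> \<epsilon>" if x: "x \<in> {- 1 / \<epsilon>..1 / \<epsilon>}" for x
    proof -
      have "2 / \<epsilon> \<le> real n * h"
        using n pos_divide_le_eq[OF h(1)] by blast
      then have "2 / \<epsilon> \<le> real (Suc n) * h"
        using h by (simp add: algebra_simps)
      with x have "t \<le> x" "x \<le> t + real (Suc n) * h"
        unfolding t_def by (simp_all del: of_nat_Suc)
      from interpolation_error[OF f h(1) this] h(2) show ?thesis
        unfolding net by linarith
    qed
    then have "approx_cost f \<epsilon> \<le> ennreal (1 / 2 * param_norm_sq n a w b)"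
      unfolding approx_cost_def by (intro Inf_lower) blast
    \<comment> \<open>Here the samples of \<open>f\<close> are traded for integrals against
      \<mu>.\<close>
    also have "\<dots> = (\<Sum>k = 1..n. ennreal (weight (?s k)) * ennreal \<bar>signed_integral \<mu> (hat h (?s k))\<bar>)"
      unfolding norm signed_integral_hat[OF cf \<mu> h(1)]
      using weight_pos by (simp add: ennreal_mult[symmetric] less_imp_le mult.commute)
    also have "\<dots> \<le> (\<Sum>k = 1..n. ennreal (weight (?s k)) * (\<integral>\<^sup>+ x. ennreal (hat h (?s k) x) \<partial>total_variation \<mu>))"
      by (intro sum_mono mult_left_mono abs_signed_integral_hat_le h) simp
    also have "\<dots> = (\<integral>\<^sup>+ x. (\<Sum>k = 1..n. ennreal (weight (?s k)) * ennreal (hat h (?s k) x)) \<partial>total_variation \<mu>)"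
      by (simp add: nn_integral_sum nn_integral_cmult)
    also have "\<dots> = (\<integral>\<^sup>+ x. ennreal (\<Sum>k = 1..n. weight (?s k) * hat h (?s k) x) \<partial>total_variation \<mu>)"
      using weight_pos hat_nonneg[OF h(1)]
      by (simp only: ennreal_mult'[symmetric] less_imp_le sum_ennreal mult_nonneg_nonneg)
    also have "\<dots> \<le> (\<integral>\<^sup>+ x. ennreal ((1 + h) * weight x) \<partial>total_variation \<mu>)"
      by (intro nn_integral_mono ennreal_leI hat_interpolation_weight_le h)
    also have "\<dots> = ennreal (1 + h) * ?W"
      using h weight_pos by (simp add: ennreal_mult less_imp_le nn_integral_cmult)
    finally show ?thesis .
  qed
  show ?thesis
  proof (rule ennreal_le_epsilon)
    fix e :: real assume W: "?W < top" and e: "0 < e"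
    then obtain r where r: "0 \<le> r" "?W = ennreal r"
      by (cases ?W) auto
    \<comment> \<open>The summands 1 keep the denominators positive when L or r is 0.\<close>
    define h where "h = min (\<epsilon> / (2 * L + 1)) (e / (r + 1))"
    have h: "0 < h" "h \<le> \<epsilon> / (2 * L + 1)" "h \<le> e / (r + 1)"
      using \<epsilon> e L r by (auto simp: h_def)
    have "(2 * L + 1) * h \<le> \<epsilon>" "(r + 1) * h \<le> e"
      using h L r by (simp_all add: pos_le_divide_eq mult.commute)
    then have "2 * L * h \<le> \<epsilon>" and hr: "h * r \<le> e"
      using h by (simp_all add: algebra_simps)
    from *[OF h(1) this(1)] have "approx_cost f \<epsilon> \<le> ennreal ((1 + h) * r)"
      using r h by (simp add: ennreal_mult)
    also have "\<dots> \<le> ennreal (r + e)"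
      using hr by (intro ennreal_leI) (simp add: algebra_simps)
    finally show "approx_cost f \<epsilon> \<le> ?W + ennreal e"
      using r e by simp
  qed
qed

lemma Rbar1_le:
  assumes "\<And>\<epsilon>. 0 < \<epsilon> \<Longrightarrow> approx_cost f \<epsilon> \<le> W"
  shows "Rbar1 f \<le> W"
  by (rule tendsto_upperbound[OF approx_cost_tendsto_Rbar1])
    (use assms in \<open>auto simp: eventually_at_right_field intro: exI[of _ 1]\<close>)

lemma approx_cost_le_Rbar1:
  assumes "0 < \<epsilon>"
  shows "approx_cost f \<epsilon> \<le> Rbar1 f"
proof (rule tendsto_lowerbound[OF approx_cost_tendsto_Rbar1])
  show "\<forall>\<^sub>F \<delta> in at_right 0. approx_cost f \<epsilon> \<le> approx_cost f \<delta>"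
    using assms approx_cost_antimono by (auto simp: eventually_at_right_field intro!: exI[of _ \<epsilon>])
qed simp

section \<open>Second derivatives from networks\<close>

text \<open>Taking \<epsilon> = 1 / (n + 1) improves the precision and the range together. The slack
  in the cost is there because the infimum need not be attained.\<close>

lemma approximating_networks:
  assumes C: "0 \<le> C" and Rb: "Rbar1 f = ennreal C"
  obtains m :: "nat \<Rightarrow> nat" and a w b :: "nat \<Rightarrow> nat \<Rightarrow> real" and a0 b0 :: "nat \<Rightarrow> real"
  where "\<And>n. 1 / 2 * param_norm_sq (m n) (a n) (w n) (b n) \<le> C + 1 / real (Suc n)"
    "\<And>n x. \<bar>x\<bar> \<le> real (Suc n) \<Longrightarrow> \<bar>network (m n) (a n) (w n) (b n) (a0 n) (b0 n) x - f x\<bar> \<le> 1 / real (Suc n)"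
proof -
  have "\<exists>m a w b a0 b0. 1 / 2 * param_norm_sq m a w b \<le> C + 1 / real (Suc n) \<and>
      (\<forall>x. \<bar>x\<bar> \<le> real (Suc n) \<longrightarrow> \<bar>network m a w b a0 b0 x - f x\<bar> \<le> 1 / real (Suc n))" for n
  proof -
    have "approx_cost f (1 / real (Suc n)) \<le> ennreal C"
      using approx_cost_le_Rbar1[of "1 / real (Suc n)" f] Rb by simp
    also have "\<dots> < ennreal (C + 1 / real (Suc n))"
      using C by (intro ennreal_lessI) (auto simp: add_nonneg_pos)
    finally obtain m a w b a0 b0 where
      *: "ennreal (1 / 2 * param_norm_sq m a w b) < ennreal (C + 1 / real (Suc n))"
        "\<forall>x \<in> {- 1 / (1 / real (Suc n))..1 / (1 / real (Suc n))}. \<bar>network m a w b a0 b0 x - f x\<bar> \<le> 1 / real (Suc n)"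
      unfolding approx_cost_def Inf_less_iff by blast
    have "1 / 2 * param_norm_sq m a w b \<le> C + 1 / real (Suc n)"
      using *(1) ennreal_leI[of "C + 1 / real (Suc n)" "1 / 2 * param_norm_sq m a w b"] by force
    moreover have "\<forall>x. \<bar>x\<bar> \<le> real (Suc n) \<longrightarrow> \<bar>network m a w b a0 b0 x - f x\<bar> \<le> 1 / real (Suc n)"
      using *(2) by (auto simp: abs_le_iff)
    ultimately show ?thesis by blast
  qed
  then obtain m a w b a0 b0 where
    "\<And>n. 1 / 2 * param_norm_sq (m n) (a n) (w n) (b n) \<le> C + 1 / real (Suc n) \<and>
      (\<forall>x. \<bar>x\<bar> \<le> real (Suc n) \<longrightarrow> \<bar>network (m n) (a n) (w n) (b n) (a0 n) (b0 n) x - f x\<bar> \<le> 1 / real (Suc n))"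
    by metis
  then show thesis
    by (intro that) blast+
qed

lemma eventually_abs_le_real_Suc: "\<forall>\<^sub>F n in sequentially. \<bar>x::real\<bar> \<le> real (Suc n)"
proof -
  obtain N where "\<bar>x\<bar> \<le> real N"
    using real_arch_simple by blast
  then show ?thesis
    by (intro eventually_sequentiallyI[of N]) auto
qed

lemma tendsto_if_locally_close:
  fixes f :: "real \<Rightarrow> real"
  assumes "\<And>n x. \<bar>x\<bar> \<le> real (Suc n) \<Longrightarrow> \<bar>g n x - f x\<bar> \<le> 1 / real (Suc n)"
  shows "(\<lambda>n. g n x) \<longlonglongrightarrow> f x"
proof -
  have "(\<lambda>n. g n x - f x) \<longlonglongrightarrow> 0"
  proof (rule Lim_null_comparison[OF _ LIMSEQ_Suc[OF lim_const_over_n]])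
    show "\<forall>\<^sub>F n in sequentially. norm (g n x - f x) \<le> 1 / real (Suc n)"
      using eventually_abs_le_real_Suc[of x] by eventually_elim (simp add: assms del: of_nat_Suc)
  qed
  then show ?thesis by (simp add: LIM_zero_iff)
qed

text \<open>For a network, the combination of second differences is the pairing of its point masses
  with the hat interpolant \<psi> of the \<open>u k\<close>, and \<psi> stays below 1 + h times the
  weight. Only finitely many sample points occur, so pointwise convergence of the networks carries
  the bound over to \<open>f\<close>.\<close>

lemma abs_sum_second_diff_le:
  assumes C: "0 \<le> C" and Rb: "Rbar1 f = ennreal C" and h: "0 < h"
    and u: "\<And>k. k \<in> {1..N} \<Longrightarrow> \<bar>u k\<bar> \<le> weight (t + real k * h)"
  shows "\<bar>\<Sum>k = 1..N. u k * second_diff h f (t + real k * h)\<bar> \<le> (1 + h) * C"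
proof -
  let ?s = "\<lambda>k. t + real k * h"
  obtain m a w b a0 b0 where
    norm: "\<And>n. 1 / 2 * param_norm_sq (m n) (a n) (w n) (b n) \<le> C + 1 / real (Suc n)" and
    net: "\<And>n x. \<bar>x\<bar> \<le> real (Suc n) \<Longrightarrow> \<bar>network (m n) (a n) (w n) (b n) (a0 n) (b0 n) x - f x\<bar> \<le> 1 / real (Suc n)"
    using approximating_networks[OF C Rb] by blast
  define g where "g n = network (m n) (a n) (w n) (b n) (a0 n) (b0 n)" for n
  have one: "(\<lambda>n. 1 / real (Suc n)) \<longlonglongrightarrow> 0"
    by (rule LIMSEQ_Suc[OF lim_const_over_n])
  have lim: "(\<lambda>n. g n x) \<longlonglongrightarrow> f x" for x
    unfolding g_def by (rule tendsto_if_locally_close) (rule net)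
  define \<psi> where "\<psi> x = (\<Sum>k = 1..N. u k * hat h (?s k) x)" for x
  have \<psi>: "\<bar>\<psi> x\<bar> \<le> (1 + h) * weight x" for x
  proof -
    have "\<bar>\<psi> x\<bar> \<le> (\<Sum>k = 1..N. \<bar>u k * hat h (?s k) x\<bar>)"
      unfolding \<psi>_def by (rule sum_abs)
    also have "\<dots> \<le> (\<Sum>k = 1..N. weight (?s k) * hat h (?s k) x)"
      using u hat_nonneg[OF h] by (intro sum_mono) (simp add: abs_mult mult_right_mono)
    also have "\<dots> \<le> (1 + h) * weight x"
      by (rule hat_interpolation_weight_le[OF h])
    finally show ?thesis .
  qed
  have "\<bar>\<Sum>k = 1..N. u k * second_diff h (g n) (?s k)\<bar> \<le> (1 + h) * (C + 1 / real (Suc n))" for n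
  proof -
    have "(\<Sum>k = 1..N. u k * second_diff h (g n) (?s k)) =
        (\<Sum>k = 1..N. \<Sum>j = 1..m n. a n j * \<bar>w n j\<bar> * (u k * hat h (?s k) (- b n j / w n j)))"
      unfolding g_def second_diff_network[OF h] by (simp add: sum_distrib_left mult_ac)
    also have "\<dots> = (\<Sum>j = 1..m n. a n j * \<bar>w n j\<bar> * \<psi> (- b n j / w n j))"
      unfolding \<psi>_def by (subst sum.swap) (simp add: sum_distrib_left)
    finally have "\<bar>\<Sum>k = 1..N. u k * second_diff h (g n) (?s k)\<bar> \<le>
        (1 + h) * (1 / 2 * param_norm_sq (m n) (a n) (w n) (b n))"
      using abs_sum_breakpoint_le[OF \<psi>] by simp
    also have "\<dots> \<le> (1 + h) * (C + 1 / real (Suc n))"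
      using h norm by (intro mult_left_mono) auto
    finally show ?thesis .
  qed
  moreover have "(\<lambda>n. (1 + h) * (C + 1 / real (Suc n))) \<longlonglongrightarrow> (1 + h) * (C + 0)"
    by (intro tendsto_intros one)
  moreover have "(\<lambda>n. \<bar>\<Sum>k = 1..N. u k * second_diff h (g n) (?s k)\<bar>) \<longlonglongrightarrow>
      \<bar>\<Sum>k = 1..N. u k * second_diff h f (?s k)\<bar>"
    unfolding second_diff_def using h by (intro tendsto_intros lim) auto
  ultimately have "\<bar>\<Sum>k = 1..N. u k * second_diff h f (?s k)\<bar> \<le> (1 + h) * (C + 0)"
    by (intro LIMSEQ_le) auto
  then show ?thesis by simp
qed

section \<open>Duality: from continuous functions below the weight to the total variation\<close>

text \<open>Hat interpolants of \<psi> have node values below the weight, so the discrete bound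
  applies to them. They converge to \<psi> pointwise with a common bound and a common
  support.\<close>

lemma signed_integral_continuous_le:
  assumes C: "0 \<le> C" "Rbar1 f = ennreal C" and f: "continuous_on UNIV f" "is_deriv2_measure f \<mu>"
    and \<psi>: "continuous_on UNIV \<psi>" "\<And>x. \<bar>\<psi> x\<bar> \<le> weight x" "\<And>x. R < \<bar>x\<bar> \<Longrightarrow> \<psi> x = 0" and R: "0 < R"
  shows "signed_integral \<mu> \<psi> \<le> C"
proof -
  \<comment> \<open>The grid cuts [- 2 R, 2 R] into 4 (j + 1) cells and uses only the 4 (j + 1) - 1
    inner nodes, so the interpolants vanish outside this interval. As the mesh is at most R, the
    points of [- R, R] lie where the hats sum to 1.\<close>
  define h where "h j = R / real (Suc j)" for j
  define N where "N j = 4 * Suc j - 1" for j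
  define s where "s j k = - (2 * R) + real k * h j" for j k
  define g where "g j x = (\<Sum>k = 1..N j. \<psi> (s j k) * hat (h j) (s j k) x)" for j x
  have h: "0 < h j" for j
    using R by (simp add: h_def)
  have hR: "h j \<le> R" for j
    using R by (simp add: h_def divide_le_eq mult_le_cancel_left1)
  have Nh: "real (N j) * h j = 4 * R - h j" for j
    by (simp add: N_def h_def of_nat_diff left_diff_distrib field_simps)
  have h0: "h \<longlonglongrightarrow> 0"
    unfolding h_def by (rule LIMSEQ_Suc[OF lim_const_over_n])
  obtain B where B: "0 \<le> B" "\<And>x. \<bar>\<psi> x\<bar> \<le> B"
    using continuous_compact_support_bounded[OF \<psi>(1,3)] by blast
  have "(\<lambda>j. signed_integral \<mu> (g j)) \<longlonglongrightarrow> signed_integral \<mu> \<psi>"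
  proof (rule signed_integral_tendsto[where B = B and R = "2 * R"])
    show "g j \<in> borel_measurable borel" for j
      unfolding g_def[abs_def] by measurable
    show "\<psi> \<in> borel_measurable borel"
      by (rule borel_measurable_continuous_onI[OF \<psi>(1)])
    show "\<bar>g j x\<bar> \<le> B" for j x
      using hat_interpolation_error[OF h B(1), of "N j" x "- (2 * R)" j "\<lambda>k. \<psi> (s j k)" 0] B(2)
      by (simp add: g_def s_def)
    show "g j x = 0" if "2 * R < \<bar>x\<bar>" for j x
    proof -
      have "hat (h j) (s j k) x = 0" if k: "k \<in> {1..N j}" for k
      proof (rule hat_eq_0[OF h])
        have "1 * h j \<le> real k * h j" "real k * h j \<le> real (N j) * h j"
          using k h[of j] by (auto intro!: mult_right_mono)
        then have "- (2 * R) + h j \<le> s j k" "s j k \<le> 2 * R - h j"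
          unfolding s_def Nh by auto
        with \<open>2 * R < \<bar>x\<bar>\<close> show "h j \<le> \<bar>x - s j k\<bar>"
          by linarith
      qed
      then show ?thesis by (simp add: g_def)
    qed
    show "(\<lambda>j. g j x) \<longlonglongrightarrow> \<psi> x" for x
    proof (rule LIMSEQ_I)
      fix e :: real assume e: "0 < e"
      have "isCont \<psi> x"
        using \<psi>(1) by (simp add: continuous_on_eq_continuous_at)
      then obtain d where d: "0 < d" "\<And>y. \<bar>y - x\<bar> < d \<Longrightarrow> \<bar>\<psi> y - \<psi> x\<bar> < e / 2"
        using e unfolding continuous_at_eps_delta dist_real_def by (metis half_gt_zero)
      from h0 d(1) obtain j0 where j0: "\<And>j. j \<ge> j0 \<Longrightarrow> \<bar>h j\<bar> < d"
        unfolding LIMSEQ_iff by (auto simp: dist_real_def)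
      have "norm (g j x - \<psi> x) < e" if "j0 \<le> j" for j
      proof -
        have "\<bar>g j x - \<psi> x\<bar> \<le> e / 2"
          unfolding g_def s_def
        proof (rule hat_interpolation_error[OF h])
          show "\<bar>\<psi> (- (2 * R) + real k * h j) - \<psi> x\<bar> \<le> e / 2"
            if "\<bar>x - (- (2 * R) + real k * h j)\<bar> < h j" for k
            using that j0[OF \<open>j0 \<le> j\<close>] by (intro less_imp_le d(2)) linarith
          show "\<psi> x = 0 \<or> - (2 * R) + h j \<le> x \<and> x \<le> - (2 * R) + real (N j) * h j"
            unfolding Nh using \<psi>(3)[of x] hR[of j] by (cases "R < \<bar>x\<bar>") auto
        qed (use e in simp)
        with e show ?thesis by simp
      qed
      then show "\<exists>j0. \<forall>j\<ge>j0. norm (g j x - \<psi> x) < e" by blast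
    qed
  qed
  moreover have "signed_integral \<mu> (g j) \<le> (1 + h j) * C" for j
  proof -
    have "signed_integral \<mu> (g j) = (\<Sum>k = 1..N j. \<psi> (s j k) * second_diff (h j) f (s j k))"
      unfolding g_def[abs_def] by (simp add: signed_integral_sum_hat[OF h] signed_integral_hat[OF f h])
    also have "\<dots> \<le> (1 + h j) * C"
      using abs_sum_second_diff_le[OF C h, of "N j" "\<lambda>k. \<psi> (s j k)" "- (2 * R)" j] \<psi>(2)
      unfolding s_def by (simp add: abs_le_iff)
    finally show ?thesis .
  qed
  moreover have "(\<lambda>j. (1 + h j) * C) \<longlonglongrightarrow> (1 + 0) * C"
    by (intro tendsto_intros h0)
  ultimately have "signed_integral \<mu> \<psi> \<le> (1 + 0) * C"
    by (intro LIMSEQ_le) auto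
  then show ?thesis by simp
qed

lemma compact_indicator_approximation:
  fixes K :: "real set"
  assumes K: "compact K"
  obtains g :: "nat \<Rightarrow> real \<Rightarrow> real" and R where "0 < R" "\<And>n. continuous_on UNIV (g n)"
    "\<And>n x. 0 \<le> g n x" "\<And>n x. g n x \<le> 1" "\<And>n x. R < \<bar>x\<bar> \<Longrightarrow> g n x = 0" "\<And>x. (\<lambda>n. g n x) \<longlonglongrightarrow> indicator K x"
proof (cases "K = {}")
  \<comment> \<open>Separate because \<open>infdist\<close> to the empty set is 0, which would make
    the approximations below constantly 1.\<close>
  case True
  show thesis
    by (rule that[of 1 "\<lambda>_ _. 0"]) (simp_all add: True)
next
  case False
  define g where "g n x = max 0 (1 - real (Suc n) * infdist x K)" for n x
  obtain r where r: "0 < r" "\<And>x. x \<in> K \<Longrightarrow> \<bar>x\<bar> \<le> r"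
    using compact_imp_bounded[OF K] unfolding bounded_pos by auto
  show thesis
  proof (rule that[of "r + 1" g])
    show "continuous_on UNIV (g n)" for n
      unfolding g_def[abs_def] by (intro continuous_intros)
    show "g n x = 0" if "r + 1 < \<bar>x\<bar>" for n x
    proof -
      obtain y where "y \<in> K" "infdist x K = dist x y"
        using infdist_attains_inf[OF compact_imp_closed[OF K] False] by metis
      with r(2)[of y] that have "1 < infdist x K"
        by (simp add: dist_real_def)
      then have "1 * 1 < real (Suc n) * infdist x K"
        by (intro mult_le_less_imp_less) auto
      then show ?thesis by (simp add: g_def)
    qed
    show "(\<lambda>n. g n x) \<longlonglongrightarrow> indicator K x" for x
    proof (cases "x \<in> K")
      case True
      then show ?thesis by (simp add: g_def)
    next
      case F: False
      then have d: "0 < infdist x K"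
        using infdist_pos_not_in_closed[OF compact_imp_closed[OF K] False] by blast
      obtain n0 where "1 / infdist x K \<le> real n0"
        using real_arch_simple by blast
      have "g n x = 0" if "n0 \<le> n" for n
      proof -
        have "1 / infdist x K \<le> real (Suc n)"
          using \<open>1 / infdist x K \<le> real n0\<close> that by simp
        then have "1 \<le> real (Suc n) * infdist x K"
          using d by (simp add: pos_divide_le_eq)
        then show ?thesis by (simp add: g_def)
      qed
      then show ?thesis
        using F by (intro tendsto_eventually eventually_sequentiallyI[of n0]) simp
    qed
  qed (use r in \<open>auto simp: g_def infdist_nonneg\<close>)
qed

text \<open>The function weight times the difference of the indicators plays the part of the weight
  times the sign of \<mu>: on \<open>K1\<close> only the positive part has mass, on
  \<open>K2\<close> only the negative one. Its continuous approximations stay below the weight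
  because a difference of two numbers in [0, 1] has modulus at most 1.\<close>

lemma weight_compact_sets_le:
  assumes C: "0 \<le> C" "Rbar1 f = ennreal C" and f: "continuous_on UNIV f" "is_deriv2_measure f \<mu>"
    and K1: "compact K1" "emeasure (negative_variation \<mu>) K1 = 0"
    and K2: "compact K2" "emeasure (positive_variation \<mu>) K2 = 0"
  shows "(\<integral>\<^sup>+ x. ennreal (weight x * indicator K1 x) \<partial>total_variation \<mu>)
    + (\<integral>\<^sup>+ x. ennreal (weight x * indicator K2 x) \<partial>total_variation \<mu>) \<le> ennreal C"
proof -
  let ?P = "positive_variation \<mu>" and ?N = "negative_variation \<mu>"
  obtain g1 R1 where g1: "0 < R1" "\<And>n. continuous_on UNIV (g1 n)"
    "\<And>n x. 0 \<le> g1 n x" "\<And>n x. g1 n x \<le> (1::real)" "\<And>n x. R1 < \<bar>x\<bar> \<Longrightarrow> g1 n x = 0"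
    "\<And>x. (\<lambda>n. g1 n x) \<longlonglongrightarrow> indicator K1 x"
    by (rule compact_indicator_approximation[OF K1(1)], rule that)
  obtain g2 R2 where g2: "0 < R2" "\<And>n. continuous_on UNIV (g2 n)"
    "\<And>n x. 0 \<le> g2 n x" "\<And>n x. g2 n x \<le> (1::real)" "\<And>n x. R2 < \<bar>x\<bar> \<Longrightarrow> g2 n x = 0"
    "\<And>x. (\<lambda>n. g2 n x) \<longlonglongrightarrow> indicator K2 x"
    by (rule compact_indicator_approximation[OF K2(1)], rule that)
  have [measurable]: "K1 \<in> sets borel" "K2 \<in> sets borel"
    using K1(1) K2(1) by (auto intro: borel_compact)
  define R where "R = max R1 R2"
  define \<psi> where "\<psi> n x = weight x * (g1 n x - g2 n x)" for n x
  let ?\<psi> = "\<lambda>x. weight x * (indicator K1 x - indicator K2 x)"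
  have c\<psi>: "continuous_on UNIV (\<psi> n)" for n
    unfolding \<psi>_def[abs_def] by (intro continuous_intros g1 g2)
  have w\<psi>: "\<bar>\<psi> n x\<bar> \<le> weight x" for n x
  proof -
    have "\<bar>g1 n x - g2 n x\<bar> \<le> 1"
      using g1(3,4)[of n x] g2(3,4)[of n x] by linarith
    then show ?thesis
      using weight_pos[of x] by (simp add: \<psi>_def abs_mult mult_left_le)
  qed
  have s\<psi>: "\<psi> n x = 0" if "R < \<bar>x\<bar>" for n x
    using that g1(5)[of x n] g2(5)[of x n] by (simp add: \<psi>_def R_def)
  have "(\<lambda>n. signed_integral \<mu> (\<psi> n)) \<longlonglongrightarrow> signed_integral \<mu> ?\<psi>"
  \<comment> \<open>The bound is \<open>weight x \<le> 1 + \<bar>x\<bar>\<close> on the common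
    support.\<close>
  proof (rule signed_integral_tendsto[where B = "1 + R" and R = R])
    show "\<psi> n \<in> borel_measurable borel" for n
      by (rule borel_measurable_continuous_onI[OF c\<psi>])
    show "\<bar>\<psi> n x\<bar> \<le> 1 + R" for n x
    proof (cases "R < \<bar>x\<bar>")
      case True
      then show ?thesis
        using s\<psi>[of x n] g1(1) by (simp add: R_def)
    next
      case False
      moreover have "weight x \<le> 1 + \<bar>x\<bar>"
        using abs_weight_diff_le[of x 0] by (simp add: weight_def)
      ultimately show ?thesis
        using w\<psi>[of n x] by linarith
    qed
    show "(\<lambda>n. \<psi> n x) \<longlonglongrightarrow> ?\<psi> x" for x
      unfolding \<psi>_def by (intro tendsto_intros g1 g2)
  qed (use s\<psi> in auto)
  moreover have "signed_integral \<mu> (\<psi> n) \<le> C" for n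
  proof (rule signed_integral_continuous_le[OF C f c\<psi> w\<psi>])
    show "\<psi> n x = 0" if "R < \<bar>x\<bar>" for x
      using that by (rule s\<psi>)
    show "0 < R"
      using g1(1) by (simp add: R_def)
  qed
  ultimately have le: "signed_integral \<mu> ?\<psi> \<le> C"
    by (intro LIMSEQ_le_const2) auto
  have int: "integrable M (\<lambda>x. weight x * indicator K x)" if M: "radon M" and K: "compact K" for M K
  proof -
    obtain r where r: "\<And>x. x \<in> K \<Longrightarrow> \<bar>x\<bar> \<le> r"
      using compact_imp_bounded[OF K] unfolding bounded_iff by auto
    have [measurable]: "K \<in> sets borel"
      using K by (rule borel_compact)
    show ?thesis
    proof (rule radon_integrable[OF M, where R = r and B = "1 + \<bar>r\<bar>"])
      show "\<bar>weight x * indicator K x\<bar> \<le> 1 + \<bar>r\<bar>" for x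
        using abs_weight_diff_le[of x 0] weight_pos[of x] r[of x] by (auto simp: weight_def indicator_def)
      show "weight x * indicator K x = 0" if "r < \<bar>x\<bar>" for x
        using r[of x] that by (auto simp: indicator_def)
    qed measurable
  qed
  have nul: "AE x in ?P. x \<notin> K2" "AE x in ?N. x \<notin> K1"
    using K1(2) K2(2) by (auto intro!: AE_not_in simp: null_sets_def)
  have "(LINT x|?P. ?\<psi> x) = (LINT x|?P. weight x * indicator K1 x)"
    using nul(1) by (intro integral_cong_AE) (auto elim!: eventually_mono)
  moreover have "(LINT x|?N. ?\<psi> x) = (LINT x|?N. - (weight x * indicator K2 x))"
    using nul(2) by (intro integral_cong_AE) (auto elim!: eventually_mono)
  ultimately have "(LINT x|?P. weight x * indicator K1 x) + (LINT x|?N. weight x * indicator K2 x) \<le> C"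
    using le by (simp add: signed_integral_def)
  moreover have eq: "(\<integral>\<^sup>+ x. ennreal (weight x * indicator K x) \<partial>M) = ennreal (LINT x|M. weight x * indicator K x)"
    if "radon M" "compact K" for M K
    using int[OF that] weight_pos by (intro nn_integral_eq_integral) (auto simp: less_imp_le)
  have z: "(\<integral>\<^sup>+ x. ennreal (weight x * indicator K1 x) \<partial>?N) = 0" "(\<integral>\<^sup>+ x. ennreal (weight x * indicator K2 x) \<partial>?P) = 0"
    using nul by (auto simp: nn_integral_0_iff_AE elim!: eventually_mono)
  moreover have "0 \<le> (LINT x|M. weight x * indicator K x)" for M :: "real measure" and K
    using weight_pos by (intro integral_nonneg_AE) (auto simp: less_imp_le)
  ultimately show ?thesis
    by (subst (1 2) nn_integral_total_variation)
      (auto simp: eq radon_variation K1 K2 ennreal_plus[symmetric] simp del: ennreal_plus intro!: ennreal_leI)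
qed

text \<open>Inner regularity applied to the two sets of a Hahn decomposition.\<close>

lemma weighted_tv_le_Rbar1:
  assumes C: "0 \<le> C" "Rbar1 f = ennreal C" and f: "continuous_on UNIV f" "is_deriv2_measure f \<mu>"
  shows "(\<integral>\<^sup>+ x. ennreal (weight x) \<partial>total_variation \<mu>) \<le> ennreal C"
proof -
  let ?P = "positive_variation \<mu>" and ?N = "negative_variation \<mu>" and ?T = "total_variation \<mu>"
  obtain A where A: "A \<in> sets borel" "emeasure ?P A = 0" "emeasure ?N (- A) = 0"
    using singular_variation[of \<mu>] by (auto simp: mutually_singular_def)
  have bound: "(\<integral>\<^sup>+ x. ennreal (weight x * indicator {- real n..real n} x) \<partial>?T) \<le> ennreal C" for n
  proof -
    \<comment> \<open>\<open>inner_regular\<close> is applied to a finite measure, hence the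
      truncation to [- n, n]. With the weight in the density, the mass of \<nu> is the quantity to
      be bounded.\<close>
    define \<nu> where "\<nu> = density ?T (\<lambda>x. ennreal (weight x * indicator {- real n..real n} x))"
    have [simp]: "sets \<nu> = sets borel" "space \<nu> = UNIV"
      using sets_eq_imp_space_eq[OF sets_total_variation, of \<mu>] by (simp_all add: \<nu>_def)
    have em: "emeasure \<nu> K = (\<integral>\<^sup>+ x. ennreal (weight x * indicator (K \<inter> {- real n..real n}) x) \<partial>?T)"
      if "K \<in> sets borel" for K
      unfolding \<nu>_def using that
      by (subst emeasure_density) (auto intro!: nn_integral_cong split: split_indicator)
    have fin: "emeasure ?T {- real n..real n} < \<infinity>"
      using radon_variation[of \<mu>] by (simp add: emeasure_total_variation radon_def)
    have "emeasure \<nu> UNIV \<le> (\<integral>\<^sup>+ x. ennreal (1 + real n) * indicator {- real n..real n} x \<partial>?T)"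
    proof -
      have "ennreal (weight x * indicator {- real n..real n} x) \<le> ennreal (1 + real n) * indicator {- real n..real n} x" for x
      proof (cases "x \<in> {- real n..real n}")
        case True
        then have "weight x \<le> 1 + real n"
          using abs_weight_diff_le[of x 0] by (auto simp: weight_def)
        then show ?thesis
          using True by (simp only: indicator_simps mult_1_right ennreal_leI)
      qed simp
      then show ?thesis
        by (subst em) (simp_all only: Int_UNIV_left space_in_borel nn_integral_mono)
    qed
    also have "\<dots> < \<infinity>"
      using fin by (subst nn_integral_cmult_indicator) (auto simp: ennreal_mult_less_top)
    finally have fin\<nu>: "emeasure \<nu> (space \<nu>) \<noteq> \<infinity>"
      by simp
    have ir: "emeasure \<nu> B = (SUP K\<in>{K. K \<subseteq> B \<and> compact K}. emeasure \<nu> K)" if "B \<in> sets borel" for B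
      using inner_regular[OF _ fin\<nu> that] by simp
    \<comment> \<open>\<open>A\<close> is null for the positive part and its complement for the
      negative part, so \<open>K1\<close> and \<open>K2\<close> see only positive and only negative
      mass, respectively.\<close>
    have le: "emeasure \<nu> K1 + emeasure \<nu> K2 \<le> ennreal C"
      if "K1 \<subseteq> - A" "compact K1" "K2 \<subseteq> A" "compact K2" for K1 K2
    proof -
      have "emeasure ?N (K1 \<inter> {- real n..real n}) \<le> emeasure ?N (- A)"
        using that A(1) by (intro emeasure_mono) auto
      moreover have "emeasure ?P (K2 \<inter> {- real n..real n}) \<le> emeasure ?P A"
        using that A(1) by (intro emeasure_mono) auto
      ultimately show ?thesis
        using weight_compact_sets_le[OF C f, of "K1 \<inter> {- real n..real n}" "K2 \<inter> {- real n..real n}"] that A(2,3)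
        by (simp add: em borel_compact compact_Int)
    qed
    have "emeasure \<nu> UNIV = emeasure \<nu> (- A) + emeasure \<nu> A"
      using A(1) by (subst plus_emeasure) (auto simp: Compl_partition2)
    also have "\<dots> = (SUP K1\<in>{K. K \<subseteq> - A \<and> compact K}. (SUP K2\<in>{K. K \<subseteq> A \<and> compact K}. emeasure \<nu> K1 + emeasure \<nu> K2))"
    proof -
      have ne: "{K. K \<subseteq> B \<and> compact K} \<noteq> {}" for B :: "real set"
        by (auto intro!: exI[of _ "{}"])
      have "- A \<in> sets borel"
        using A(1) by auto
      then have e1: "emeasure \<nu> (- A) + emeasure \<nu> A = (SUP K1\<in>{K. K \<subseteq> - A \<and> compact K}. emeasure \<nu> K1 + emeasure \<nu> A)"
        by (simp only: ennreal_SUP_add_left[OF ne] ir[of "- A"])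
      have e2: "emeasure \<nu> K1 + emeasure \<nu> A = (SUP K2\<in>{K. K \<subseteq> A \<and> compact K}. emeasure \<nu> K1 + emeasure \<nu> K2)" for K1
        by (simp only: ennreal_SUP_add_right[OF ne, symmetric] ir[OF A(1)])
      show ?thesis
        unfolding e1 by (rule SUP_cong[OF refl e2])
    qed
    also have "\<dots> \<le> ennreal C"
      using le by (intro SUP_least) auto
    finally show ?thesis
      by (simp add: em)
  qed
  \<comment> \<open>The bound is uniform in n, so monotone convergence removes the
    truncation.\<close>
  have "(\<integral>\<^sup>+ x. ennreal (weight x) \<partial>?T) = (\<integral>\<^sup>+ x. (SUP n. ennreal (weight x * indicator {- real n..real n} x)) \<partial>?T)"
  proof (intro nn_integral_cong antisym SUP_least)
    fix x :: real
    obtain n where "\<bar>x\<bar> \<le> real n"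
      using real_arch_simple by blast
    then have "ennreal (weight x) = ennreal (weight x * indicator {- real n..real n} x)"
      by (simp add: abs_le_iff)
    then show "ennreal (weight x) \<le> (SUP n. ennreal (weight x * indicator {- real n..real n} x))"
      by (intro SUP_upper2[where i = n]) auto
    show "ennreal (weight x * indicator {- real n..real n} x) \<le> ennreal (weight x)" for n
      using weight_pos[of x] by (intro ennreal_leI) (auto simp: indicator_def)
  qed
  also have "\<dots> = (SUP n. \<integral>\<^sup>+ x. ennreal (weight x * indicator {- real n..real n} x) \<partial>?T)"
    using weight_pos
    by (intro nn_integral_monotone_convergence_SUP)
      (auto simp: incseq_def le_fun_def less_imp_le intro!: ennreal_leI mult_left_mono split: split_indicator)
  also have "\<dots> \<le> ennreal C"
    by (intro SUP_least bound)
  finally show ?thesis .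
qed

section \<open>Lipschitz continuity from finite cost\<close>

text \<open>A neuron has Lipschitz constant at most \<bar>a\<bar> \<bar>w\<bar>, which the cost
  controls because the weight is at least 1. The slope \<open>a0 n\<close> of the skip connection is
  not penalised; it is bounded by comparing the network with \<open>f\<close> at 0 and 1.\<close>

lemma lipschitz_if_Rbar1_finite:
  assumes C: "0 \<le> C" "Rbar1 f = ennreal C"
  shows "\<exists>L. L-lipschitz_on UNIV f"
proof -
  obtain m a w b a0 b0 where
    norm: "\<And>n. 1 / 2 * param_norm_sq (m n) (a n) (w n) (b n) \<le> C + 1 / real (Suc n)" and
    net: "\<And>n x. \<bar>x\<bar> \<le> real (Suc n) \<Longrightarrow> \<bar>network (m n) (a n) (w n) (b n) (a0 n) (b0 n) x - f x\<bar> \<le> 1 / real (Suc n)"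
    using approximating_networks[OF C] by blast
  define g where "g n = network (m n) (a n) (w n) (b n) (a0 n) (b0 n)" for n
  define D where "D = C + 1"
  have lim: "(\<lambda>n. g n x) \<longlonglongrightarrow> f x" for x
    unfolding g_def by (rule tendsto_if_locally_close) (rule net)
  have D: "\<bar>g n x - g n y - a0 n * (x - y)\<bar> \<le> D * \<bar>x - y\<bar>" for n x y
  proof -
    have r: "\<bar>relu u - relu v\<bar> \<le> \<bar>u - v\<bar>" for u v
      by (auto simp: relu_def max_def)
    have "\<bar>g n x - g n y - a0 n * (x - y)\<bar> =
        \<bar>\<Sum>j = 1..m n. a n j * (relu (w n j * x + b n j) - relu (w n j * y + b n j))\<bar>"
      by (simp add: g_def network_def right_diff_distrib sum_subtractf)
    also have "\<dots> \<le> (\<Sum>j = 1..m n. \<bar>a n j * (relu (w n j * x + b n j) - relu (w n j * y + b n j))\<bar>)"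
      by (rule sum_abs)
    also have "\<dots> \<le> (\<Sum>j = 1..m n. \<bar>a n j\<bar> * \<bar>w n j\<bar> * weight (- b n j / w n j) * \<bar>x - y\<bar>)"
    proof (rule sum_mono)
      fix j
      have "\<bar>relu (w n j * x + b n j) - relu (w n j * y + b n j)\<bar> \<le> \<bar>w n j\<bar> * \<bar>x - y\<bar>"
        using r[of "w n j * x + b n j" "w n j * y + b n j"]
        by (simp add: abs_mult[symmetric] right_diff_distrib)
      then have "\<bar>a n j\<bar> * \<bar>relu (w n j * x + b n j) - relu (w n j * y + b n j)\<bar> \<le> \<bar>a n j\<bar> * (\<bar>w n j\<bar> * \<bar>x - y\<bar> * 1)"
        by (simp add: mult_left_mono)
      also have "\<dots> \<le> \<bar>a n j\<bar> * (\<bar>w n j\<bar> * \<bar>x - y\<bar> * weight (- b n j / w n j))"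
        by (intro mult_left_mono weight_ge_1) auto
      finally show "\<bar>a n j * (relu (w n j * x + b n j) - relu (w n j * y + b n j))\<bar> \<le>
          \<bar>a n j\<bar> * \<bar>w n j\<bar> * weight (- b n j / w n j) * \<bar>x - y\<bar>"
        by (simp add: abs_mult mult_ac)
    qed
    also have "\<dots> \<le> D * \<bar>x - y\<bar>"
    proof -
      have "1 / real (Suc n) \<le> 1"
        by simp
      then have "(\<Sum>j = 1..m n. \<bar>a n j\<bar> * \<bar>w n j\<bar> * weight (- b n j / w n j)) \<le> D"
        using sum_weight_breakpoint_le[of "a n" "w n" "b n" "m n"] norm[of n] unfolding D_def by linarith
      then show ?thesis
        unfolding sum_distrib_right[symmetric] by (intro mult_right_mono) auto
    qed
    finally show ?thesis .
  qed
  \<comment> \<open>At 0 and 1 the networks are within 1 of \<open>f\<close>, so \<bar>a0 n\<bar> is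
    at most \<bar>f 1 - f 0\<bar> + 2 + D. The second D accounts for the neurons.\<close>
  define L where "L = \<bar>f 1 - f 0\<bar> + 2 + 2 * D"
  have L: "\<bar>a0 n\<bar> + D \<le> L" for n
  proof -
    have "1 / real (Suc n) \<le> 1"
      by simp
    then have "\<bar>g n 1 - f 1\<bar> \<le> 1" "\<bar>g n 0 - f 0\<bar> \<le> 1"
      using net[of 1 n] net[of 0 n] unfolding g_def by (auto intro: order_trans)
    with D[of n 1 0] show ?thesis
      by (simp add: L_def)
  qed
  have "\<bar>f x - f y\<bar> \<le> L * \<bar>x - y\<bar>" for x y
  proof (rule LIMSEQ_le_const2)
    show "(\<lambda>n. \<bar>g n x - g n y\<bar>) \<longlonglongrightarrow> \<bar>f x - f y\<bar>"
      by (intro tendsto_intros lim)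
    have "\<bar>g n x - g n y\<bar> \<le> L * \<bar>x - y\<bar>" for n
    proof -
      have "\<bar>g n x - g n y\<bar> \<le> \<bar>a0 n * (x - y)\<bar> + D * \<bar>x - y\<bar>"
        using D[of n x y] by linarith
      also have "\<dots> = (\<bar>a0 n\<bar> + D) * \<bar>x - y\<bar>"
        by (simp add: abs_mult distrib_right)
      also have "\<dots> \<le> L * \<bar>x - y\<bar>"
        using L by (intro mult_right_mono) auto
      finally show ?thesis .
    qed
    then show "\<exists>N. \<forall>n\<ge>N. \<bar>g n x - g n y\<bar> \<le> L * \<bar>x - y\<bar>" by blast
  qed
  moreover have "0 \<le> L"
    using C by (simp add: L_def D_def)
  ultimately have "L-lipschitz_on UNIV f"
    by (intro lipschitz_onI) (auto simp: dist_real_def)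
  then show ?thesis by blast
qed

section \<open>Distributional second derivatives of networks\<close>

lemma radon_lborel: "radon lborel"
  by (simp add: radon_def emeasure_bounded_finite compact_imp_bounded del: infinity_ennreal_def)

lemma test_functionE:
  assumes "test_function \<phi>"
  obtains \<phi>' R where "0 < R" "\<And>x. (\<phi> has_real_derivative \<phi>' x) (at x)"
    "\<And>x. (\<phi>' has_real_derivative (deriv ^^ 2) \<phi> x) (at x)" "continuous_on UNIV ((deriv ^^ 2) \<phi>)"
    "\<And>x. R \<le> \<bar>x\<bar> \<Longrightarrow> \<phi> x = 0" "\<And>x. R \<le> \<bar>x\<bar> \<Longrightarrow> \<phi>' x = 0" "\<And>x. R \<le> \<bar>x\<bar> \<Longrightarrow> (deriv ^^ 2) \<phi> x = 0"
proof -
  from assms obtain R where sm: "smooth \<phi>" and R: "\<And>x. R \<le> \<bar>x\<bar> \<Longrightarrow> \<phi> x = 0"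
    by (auto simp: test_function_iff)
  have vanish: "g' x = 0" if g: "\<And>x. (g has_real_derivative g' x) (at x)" "\<And>x. r \<le> \<bar>x\<bar> \<Longrightarrow> g x = 0" "r < \<bar>x\<bar>"
    for g g' :: "real \<Rightarrow> real" and r x
  proof -
    have "open (- cball 0 r :: real set)"
      by (simp add: open_Compl)
    then have "(g has_real_derivative 0) (at x)"
      by (rule has_field_derivative_transform_within_open[OF DERIV_const[of 0]])
        (use g(2)[symmetric] g(3) in \<open>auto simp: dist_real_def\<close>)
    with g(1) show ?thesis
      by (rule DERIV_unique)
  qed
  have d1: "(\<phi> has_real_derivative deriv \<phi> x) (at x)" for x
    using smoothD[OF sm, of 0 x] by simp
  have d2: "(deriv \<phi> has_real_derivative (deriv ^^ 2) \<phi> x) (at x)" for x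
    using smoothD[OF sm, of 1 x] by (simp add: numeral_2_eq_2)
  have c: "continuous_on UNIV ((deriv ^^ 2) \<phi>)"
    using smoothD[OF sm, of 2] by (auto simp: continuous_on_eq_continuous_at intro!: DERIV_isCont)
  \<comment> \<open>A derivative is known to vanish only strictly beyond the radius of its function,
    so the radius grows with each differentiation.\<close>
  have 1: "deriv \<phi> x = 0" if "\<bar>R\<bar> + 1 \<le> \<bar>x\<bar>" for x
    by (rule vanish[OF d1 R]) (use that in auto)
  have 2: "(deriv ^^ 2) \<phi> x = 0" if "\<bar>R\<bar> + 2 \<le> \<bar>x\<bar>" for x
    by (rule vanish[OF d2 1]) (use that in auto)
  show thesis
    by (rule that[of "\<bar>R\<bar> + 2", OF _ d1 d2 c _ _ 2]) (use R 1 in auto)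
qed

text \<open>Two integrations by parts, packed into the antiderivative
  \<open>(\<alpha> * x + \<beta>) * \<phi>' x - \<alpha> * \<phi> x\<close>, which vanishes at both
  ends of the support interval.\<close>

lemma distr_deriv2_affine:
  assumes "test_function \<phi>"
  shows "(LINT x|lborel. (\<alpha> * x + \<beta>) * (deriv ^^ 2) \<phi> x) = 0"
proof -
  obtain \<phi>' R where R: "0 < R" and d: "\<And>x. (\<phi> has_real_derivative \<phi>' x) (at x)"
    "\<And>x. (\<phi>' has_real_derivative (deriv ^^ 2) \<phi> x) (at x)" "continuous_on UNIV ((deriv ^^ 2) \<phi>)"
    and z: "\<And>x. R \<le> \<bar>x\<bar> \<Longrightarrow> \<phi> x = 0" "\<And>x. R \<le> \<bar>x\<bar> \<Longrightarrow> \<phi>' x = 0" "\<And>x. R \<le> \<bar>x\<bar> \<Longrightarrow> (deriv ^^ 2) \<phi> x = 0"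
    by (rule test_functionE[OF assms], rule that)
  have "(LINT x|lborel. (\<alpha> * x + \<beta>) * (deriv ^^ 2) \<phi> x * indicator {-R..R} x) =
      ((\<alpha> * R + \<beta>) * \<phi>' R - \<alpha> * \<phi> R) - ((\<alpha> * (- R) + \<beta>) * \<phi>' (- R) - \<alpha> * \<phi> (- R))"
  proof (rule integral_FTC_Icc_real)
    show "((\<lambda>x. (\<alpha> * x + \<beta>) * \<phi>' x - \<alpha> * \<phi> x) has_real_derivative (\<alpha> * x + \<beta>) * (deriv ^^ 2) \<phi> x) (at x)" for x
      by (rule DERIV_cong) (rule derivative_eq_intros d refl | simp)+
    show "isCont (\<lambda>x. (\<alpha> * x + \<beta>) * (deriv ^^ 2) \<phi> x) x" for x
      using d(3) by (intro continuous_intros) (simp add: continuous_on_eq_continuous_at)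
  qed (use R in simp)
  also have "(\<lambda>x. (\<alpha> * x + \<beta>) * (deriv ^^ 2) \<phi> x * indicator {-R..R} x) = (\<lambda>x. (\<alpha> * x + \<beta>) * (deriv ^^ 2) \<phi> x)"
  proof
    show "(\<alpha> * x + \<beta>) * (deriv ^^ 2) \<phi> x * indicator {-R..R} x = (\<alpha> * x + \<beta>) * (deriv ^^ 2) \<phi> x" for x
      using z(3)[of x] by (cases "R \<le> \<bar>x\<bar>") (auto simp: indicator_def)
  qed
  finally show ?thesis
    using R z by simp
qed

text \<open>The second derivative of a shifted ReLU is the unit mass at its breakpoint: of the
  antiderivative \<open>(x - s) * \<phi>' x - \<phi> x\<close> only the value at s survives.\<close>

lemma distr_deriv2_relu:
  assumes "test_function \<phi>"
  shows "(LINT x|lborel. relu (x - s) * (deriv ^^ 2) \<phi> x) = \<phi> s"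
proof -
  obtain \<phi>' R where R: "0 < R" and d: "\<And>x. (\<phi> has_real_derivative \<phi>' x) (at x)"
    "\<And>x. (\<phi>' has_real_derivative (deriv ^^ 2) \<phi> x) (at x)" "continuous_on UNIV ((deriv ^^ 2) \<phi>)"
    and z: "\<And>x. R \<le> \<bar>x\<bar> \<Longrightarrow> \<phi> x = 0" "\<And>x. R \<le> \<bar>x\<bar> \<Longrightarrow> \<phi>' x = 0" "\<And>x. R \<le> \<bar>x\<bar> \<Longrightarrow> (deriv ^^ 2) \<phi> x = 0"
    by (rule test_functionE[OF assms], rule that)
  \<comment> \<open>The interval from s to \<open>S\<close> must be well oriented even if s lies
    outside the support of \<phi>.\<close>
  define S where "S = max R \<bar>s\<bar>"
  have S: "s \<le> S" "R \<le> S" "R \<le> \<bar>S\<bar>"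
    using R by (auto simp: S_def)
  have "(LINT x|lborel. (x - s) * (deriv ^^ 2) \<phi> x * indicator {s..S} x) =
      ((S - s) * \<phi>' S - \<phi> S) - ((s - s) * \<phi>' s - \<phi> s)"
  proof (rule integral_FTC_Icc_real)
    show "((\<lambda>x. (x - s) * \<phi>' x - \<phi> x) has_real_derivative (x - s) * (deriv ^^ 2) \<phi> x) (at x)" for x
      by (rule DERIV_cong) (rule derivative_eq_intros d refl | simp)+
    show "isCont (\<lambda>x. (x - s) * (deriv ^^ 2) \<phi> x) x" for x
      using d(3) by (intro continuous_intros) (simp add: continuous_on_eq_continuous_at)
  qed (rule S)
  also have "(\<lambda>x. (x - s) * (deriv ^^ 2) \<phi> x * indicator {s..S} x) = (\<lambda>x. relu (x - s) * (deriv ^^ 2) \<phi> x)"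
  proof
    show "(x - s) * (deriv ^^ 2) \<phi> x * indicator {s..S} x = relu (x - s) * (deriv ^^ 2) \<phi> x" for x
      using z(3)[of x] S by (cases "x < s"; cases "S < x") (auto simp: relu_def)
  qed
  finally show ?thesis
    using z(1)[OF S(3)] z(2)[OF S(3)] by simp
qed

text \<open>Every neuron is \<bar>w\<bar> times a ReLU opening to the right, plus an affine
  function. The affine parts join the skip connection and are annihilated.\<close>

lemma distr_deriv2_network:
  assumes \<phi>: "test_function \<phi>"
  shows "distr_deriv2 (network m a w b a0 b0) \<phi> = (\<Sum>j = 1..m. a j * \<bar>w j\<bar> * \<phi> (- b j / w j))"
proof -
  \<comment> \<open>The constant left over: for w < 0, relu (- u) = relu u - u contributes w x + b,
    and for w = 0 the whole neuron is the constant \<open>relu (b j)\<close>.\<close>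
  define c where "c j = (if w j < 0 then b j else if w j = 0 then relu (b j) else 0)" for j
  have r: "relu (w j * x + b j) = \<bar>w j\<bar> * relu (x - - b j / w j) + (min (w j) 0 * x + c j)" for j x
  proof -
    consider "w j = 0" | "0 < w j" | "w j < 0" by linarith
    then show ?thesis
    proof cases
      case 1
      then show ?thesis by (simp add: c_def)
    next
      case 2
      then have "w j * x + b j = w j * (x - - b j / w j)"
        by (simp add: distrib_left)
      with 2 show ?thesis
        by (auto simp: c_def relu_def max_def zero_le_mult_iff)
    next
      case 3
      then have "w j * x + b j = w j * (x - - b j / w j)"
        by (simp add: distrib_left)
      with 3 show ?thesis
        by (auto simp: c_def relu_def max_def zero_le_mult_iff)
    qed
  qed
  define \<alpha> where "\<alpha> = a0 + (\<Sum>j = 1..m. a j * min (w j) 0)"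
  define \<beta> where "\<beta> = b0 + (\<Sum>j = 1..m. a j * c j)"
  have net: "network m a w b a0 b0 x = (\<alpha> * x + \<beta>) + (\<Sum>j = 1..m. a j * \<bar>w j\<bar> * relu (x - - b j / w j))" for x
    unfolding network_def r \<alpha>_def \<beta>_def
    by (simp add: distrib_left distrib_right sum.distrib sum_distrib_right mult.assoc)
  obtain \<phi>' R where d: "continuous_on UNIV ((deriv ^^ 2) \<phi>)" and z: "\<And>x. R \<le> \<bar>x\<bar> \<Longrightarrow> (deriv ^^ 2) \<phi> x = 0"
    using test_functionE[OF \<phi>] by metis
  have int: "integrable lborel (\<lambda>x. g x * (deriv ^^ 2) \<phi> x)" if "continuous_on UNIV g" for g
    by (rule radon_integrable_continuous[OF radon_lborel, where R = R])
      (use that d z in \<open>auto intro!: continuous_intros\<close>)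
  have cr: "continuous_on UNIV (\<lambda>x. relu (x - s))" "continuous_on UNIV (\<lambda>x. \<alpha> * x + \<beta>)" for s
    by (intro continuous_intros)+
  define \<tau> where "\<tau> j = - b j / w j" for j
  have "distr_deriv2 (network m a w b a0 b0) \<phi> = (LINT x|lborel. (\<alpha> * x + \<beta>) * (deriv ^^ 2) \<phi> x
      + (\<Sum>j = 1..m. a j * \<bar>w j\<bar> * (relu (x - \<tau> j) * (deriv ^^ 2) \<phi> x)))"
    unfolding distr_deriv2_def net \<tau>_def by (simp add: distrib_right sum_distrib_right mult.assoc)
  also have "\<dots> = (LINT x|lborel. (\<alpha> * x + \<beta>) * (deriv ^^ 2) \<phi> x)
      + (\<Sum>j = 1..m. a j * \<bar>w j\<bar> * (LINT x|lborel. relu (x - \<tau> j) * (deriv ^^ 2) \<phi> x))"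
    using int[OF cr(1)] int[OF cr(2)] by (simp add: Bochner_Integration.integral_add Bochner_Integration.integral_sum)
  finally show ?thesis
    by (simp only: distr_deriv2_affine[OF \<phi>] distr_deriv2_relu[OF \<phi>] add_0_left \<tau>_def)
qed

section \<open>Existence of the second derivative\<close>

lemma radon_sigma_finite:
  assumes "radon M"
  shows "sigma_finite_measure M"
proof
  have s: "sets M = sets borel"
    using assms by (simp add: radon_def)
  have "\<Union> (range (\<lambda>n. {- real n..real n})) = UNIV"
  proof (intro equalityI subsetI UNIV_I)
    fix x :: real
    obtain n where "\<bar>x\<bar> \<le> real n"
      using real_arch_simple by blast
    then show "x \<in> \<Union> (range (\<lambda>n. {- real n..real n}))"
      by (auto intro!: exI[of _ n])
  qed
  then show "\<exists>A. countable A \<and> A \<subseteq> sets M \<and> \<Union> A = space M \<and> (\<forall>a\<in>A. emeasure M a \<noteq> \<infinity>)"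
    using assms sets_eq_imp_space_eq[OF s]
    by (intro exI[of _ "range (\<lambda>n. {- real n..real n})"]) (auto simp: radon_def s less_top)
qed

lemma integral_measure_sum:
  fixes g :: "real \<Rightarrow> real"
  assumes M: "sets M = sets borel" "sets N = sets borel" and g: "g \<in> borel_measurable borel"
    and int: "integrable M g" "integrable N g" "integrable (measure_sum M N) g"
  shows "(LINT x|measure_sum M N. g x) = (LINT x|M. g x) + (LINT x|N. g x)"
proof -
  have fin: "(\<integral>\<^sup>+ x. ennreal (g x) \<partial>K) < top" "(\<integral>\<^sup>+ x. ennreal (- g x) \<partial>K) < top" if "integrable K g" for K
    using that by (simp_all add: real_integrable_def less_top)
  show ?thesis
    unfolding real_lebesgue_integral_def[OF int(1)] real_lebesgue_integral_def[OF int(2)]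
      real_lebesgue_integral_def[OF int(3)]
    using g fin[OF int(1)] fin[OF int(2)]
    by (simp add: nn_integral_measure_sum[OF M] enn2real_plus)
qed

text \<open>\<open>M1\<close> and \<open>M2\<close> may charge the same sets and both may have
  infinite mass, so the difference is decomposed through densities with respect to their sum, which
  is again locally finite. The positive part lives where p > 1 / 2, the negative part on the
  complement.\<close>

lemma jordan_decomposition:
  assumes M1: "radon M1" and M2: "radon M2"
  obtains \<mu> where "\<And>\<phi> R. continuous_on UNIV \<phi> \<Longrightarrow> (\<And>x. R < \<bar>x\<bar> \<Longrightarrow> \<phi> x = 0) \<Longrightarrow>
    signed_integral \<mu> \<phi> = (LINT x|M1. \<phi> x) - (LINT x|M2. \<phi> x)"
proof -
  let ?M = "measure_sum M1 M2"
  have s: "sets M1 = sets borel" "sets M2 = sets borel"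
    using M1 M2 by (simp_all add: radon_def)
  have M: "radon ?M"
    using M1 M2 by (auto simp: radon_def emeasure_measure_sum borel_compact)
  interpret sigma_finite_measure ?M
    using M by (rule radon_sigma_finite)
  have ac: "absolutely_continuous ?M M1"
    unfolding absolutely_continuous_def null_sets_def using s by (auto simp: emeasure_measure_sum)
  \<comment> \<open>With \<open>p\<close> the density of \<open>M1\<close>, the difference \<open>M1 - M2\<close> has density \<open>2 * p - 1\<close>.\<close>
  define p where "p x = enn2real (RN_deriv ?M M1 x)" for x
  have [measurable]: "p \<in> borel_measurable borel"
    unfolding p_def[abs_def] using borel_measurable_RN_deriv[of ?M M1] by measurable
  have dens: "density ?M (\<lambda>x. ennreal (p x)) = M1"
  proof -
    have "AE x in ?M. RN_deriv ?M M1 x \<noteq> \<infinity>"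
      by (rule RN_deriv_finite[OF radon_sigma_finite[OF M1] ac]) (simp add: s)
    then have "density ?M (\<lambda>x. ennreal (p x)) = density ?M (RN_deriv ?M M1)"
      by (intro density_cong) (auto simp: p_def ennreal_enn2real_if elim!: eventually_mono)
    then show ?thesis
      using density_RN_deriv[OF ac] by (simp add: s)
  qed
  have p0: "0 \<le> p x" for x
    by (simp add: p_def)
  define P where "P = density ?M (\<lambda>x. ennreal (max 0 (2 * p x - 1)))"
  define N where "N = density ?M (\<lambda>x. ennreal (max 0 (1 - 2 * p x)))"
  have sP: "sets P = sets borel" "sets N = sets borel"
    by (simp_all add: P_def N_def)
  have "radon P"
    unfolding radon_def
  proof (intro conjI allI impI)
    fix K :: "real set" assume K: "compact K"
    then have [measurable]: "K \<in> sets borel"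
      by (rule borel_compact)
    \<comment> \<open>No pointwise upper bound on \<open>p\<close> is available, so finiteness on
      compact sets comes from comparing \<open>P\<close> with twice \<open>M1\<close>; the density
      of \<open>N\<close> is at most 1 because \<open>p\<close> is nonnegative.\<close>
    have "emeasure P K \<le> (\<integral>\<^sup>+ x. 2 * (ennreal (p x) * indicator K x) \<partial>?M)"
      unfolding P_def
    proof (subst emeasure_density)
      have "ennreal (max 0 (2 * p x - 1)) \<le> ennreal (2 * p x)" for x
        using p0 by (intro ennreal_leI) auto
      then show "(\<integral>\<^sup>+ x. ennreal (max 0 (2 * p x - 1)) * indicator K x \<partial>?M) \<le> (\<integral>\<^sup>+ x. 2 * (ennreal (p x) * indicator K x) \<partial>?M)"
        by (intro nn_integral_mono) (auto simp: indicator_def ennreal_mult p0)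
    qed auto
    also have "\<dots> = 2 * emeasure (density ?M (\<lambda>x. ennreal (p x))) K"
      by (simp add: nn_integral_cmult emeasure_density)
    also have "\<dots> < \<infinity>"
      using M1 K unfolding dens by (simp add: radon_def ennreal_mult_less_top)
    finally show "emeasure P K < \<infinity>" .
  qed (rule sP)
  have "radon N"
    unfolding radon_def
  proof (intro conjI allI impI)
    fix K :: "real set" assume K: "compact K"
    then have [measurable]: "K \<in> sets borel"
      by (rule borel_compact)
    have "emeasure N K \<le> (\<integral>\<^sup>+ x. indicator K x \<partial>?M)"
      unfolding N_def
    proof (subst emeasure_density)
      have "ennreal (max 0 (1 - 2 * p x)) \<le> 1" for x
        using p0[of x] by (simp add: ennreal_le_1)
      then show "(\<integral>\<^sup>+ x. ennreal (max 0 (1 - 2 * p x)) * indicator K x \<partial>?M) \<le> (\<integral>\<^sup>+ x. indicator K x \<partial>?M)"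
        by (intro nn_integral_mono) (auto simp: indicator_def)
    qed auto
    also have "\<dots> < \<infinity>"
      using M K by (simp add: radon_def)
    finally show "emeasure N K < \<infinity>" .
  qed (rule sP)
  have "mutually_singular P N"
    unfolding mutually_singular_def
  proof (intro bexI[of _ "{x. p x \<le> 1 / 2}"] conjI)
    show A: "{x. p x \<le> 1 / 2} \<in> sets borel"
      by measurable
    show "emeasure P {x. p x \<le> 1 / 2} = 0"
      unfolding P_def using A by (subst emeasure_density) (auto simp: nn_integral_0_iff_AE indicator_def ennreal_eq_0_iff)
    have "- {x. p x \<le> 1 / 2} \<in> sets borel"
      using A by auto
    then show "emeasure N (- {x. p x \<le> 1 / 2}) = 0"
      unfolding N_def by (subst emeasure_density) (auto simp: nn_integral_0_iff_AE indicator_def ennreal_eq_0_iff)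
  qed
  define \<mu> where "\<mu> = Abs_signed_radon (P, N)"
  have "Rep_signed_radon \<mu> = (P, N)"
    unfolding \<mu>_def using \<open>radon P\<close> \<open>radon N\<close> \<open>mutually_singular P N\<close>
    by (intro Abs_signed_radon_inverse) simp
  then have \<mu>: "positive_variation \<mu> = P" "negative_variation \<mu> = N"
    by (simp_all add: positive_variation_def negative_variation_def)
  show thesis
  proof (rule that)
    fix \<phi> :: "real \<Rightarrow> real" and R :: real
    assume \<phi>: "continuous_on UNIV \<phi>" "\<And>x. R < \<bar>x\<bar> \<Longrightarrow> \<phi> x = 0"
    have [measurable]: "\<phi> \<in> borel_measurable borel"
      by (rule borel_measurable_continuous_onI[OF \<phi>(1)])
    have int: "integrable K \<phi>" if "radon K" for K
      by (rule radon_integrable_continuous[OF that \<phi>])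
    have den: "(LINT x|density ?M (\<lambda>x. ennreal (u x)). \<phi> x) = (LINT x|?M. u x * \<phi> x) \<and>
        integrable ?M (\<lambda>x. u x * \<phi> x)"
      if "radon (density ?M (\<lambda>x. ennreal (u x)))" and [measurable]: "u \<in> borel_measurable borel" and "\<And>x. 0 \<le> u x"
      for u
      using int[OF that(1)] that(3) integral_real_density[of u ?M \<phi>] integrable_real_density[of u ?M \<phi>] by simp
    have P: "(LINT x|P. \<phi> x) = (LINT x|?M. max 0 (2 * p x - 1) * \<phi> x)"
        and iP: "integrable ?M (\<lambda>x. max 0 (2 * p x - 1) * \<phi> x)"
      using den[of "\<lambda>x. max 0 (2 * p x - 1)"] \<open>radon P\<close> unfolding P_def by auto
    have N: "(LINT x|N. \<phi> x) = (LINT x|?M. max 0 (1 - 2 * p x) * \<phi> x)"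
        and iN: "integrable ?M (\<lambda>x. max 0 (1 - 2 * p x) * \<phi> x)"
      using den[of "\<lambda>x. max 0 (1 - 2 * p x)"] \<open>radon N\<close> unfolding N_def by auto
    have 1: "(LINT x|M1. \<phi> x) = (LINT x|?M. p x * \<phi> x)" and i1: "integrable ?M (\<lambda>x. p x * \<phi> x)"
      using den[of p] p0 M1 unfolding dens by auto
    have "signed_integral \<mu> \<phi> = (LINT x|?M. max 0 (2 * p x - 1) * \<phi> x - max 0 (1 - 2 * p x) * \<phi> x)"
      using iP iN by (simp add: signed_integral_def \<mu> P N)
    also have "(\<lambda>x. max 0 (2 * p x - 1) * \<phi> x - max 0 (1 - 2 * p x) * \<phi> x) = (\<lambda>x. 2 * (p x * \<phi> x) - \<phi> x)"
      by (auto simp: fun_eq_iff max_def algebra_simps)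
    \<comment> \<open>The difference appears as twice \<open>M1\<close> minus the sum of both
      measures.\<close>
    also have "(LINT x|?M. 2 * (p x * \<phi> x) - \<phi> x) = 2 * (LINT x|M1. \<phi> x) - (LINT x|?M. \<phi> x)"
      using i1 int[OF M] by (simp add: 1)
    also have "(LINT x|?M. \<phi> x) = (LINT x|M1. \<phi> x) + (LINT x|M2. \<phi> x)"
      using int[OF M1] int[OF M2] int[OF M] by (intro integral_measure_sum s) auto
    finally show "signed_integral \<mu> \<phi> = (LINT x|M1. \<phi> x) - (LINT x|M2. \<phi> x)"
      by simp
  qed
qed

section \<open>Stieltjes measures and limits of atomic measures\<close>

text \<open>Stieltjes integration by parts via Fubini: \<phi> t is minus the integral of \<phi>'
  over [t, R], and exchanging the integrals turns the measure of the half-open interval from - R to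
  x into an increment of \<open>G\<close>.\<close>

lemma integral_interval_measure:
  fixes G \<phi> \<phi>' :: "real \<Rightarrow> real"
  assumes mono: "mono G" and rc: "\<And>x. continuous (at_right x) G"
    and d: "\<And>x. (\<phi> has_real_derivative \<phi>' x) (at x)" and c: "continuous_on UNIV \<phi>'"
    and R: "0 < R" "\<And>x. R \<le> \<bar>x\<bar> \<Longrightarrow> \<phi> x = 0" "\<And>x. R \<le> \<bar>x\<bar> \<Longrightarrow> \<phi>' x = 0"
  shows "radon (interval_measure G)"
    and "(LINT x|interval_measure G. \<phi> x) = - (LINT x|lborel. \<phi>' x * G x)"
proof -
  let ?M = "interval_measure G"
  have m: "\<And>x y. x \<le> y \<Longrightarrow> G x \<le> G y"
    using mono by (simp add: mono_def)
  have Ioc: "emeasure ?M {a<..b} = ennreal (G b - G a)" if "a \<le> b" for a b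
    by (rule emeasure_interval_measure_Ioc[OF that m rc])
  show "radon ?M"
    unfolding radon_def
  proof (intro conjI allI impI)
    fix K :: "real set" assume K: "compact K"
    then obtain r where r: "0 < r" "\<And>x. x \<in> K \<Longrightarrow> \<bar>x\<bar> \<le> r"
      using compact_imp_bounded[OF K] unfolding bounded_pos by auto
    have "emeasure ?M K \<le> emeasure ?M {- r - 1<..r}"
      using r(2) by (intro emeasure_mono) (force simp: abs_le_iff)+
    also have "\<dots> < \<infinity>"
      using r(1) by (subst Ioc) auto
    finally show "emeasure ?M K < \<infinity>" .
  qed simp
  have [measurable]: "\<phi>' \<in> borel_measurable borel" "G \<in> borel_measurable borel"
    by (auto intro: borel_measurable_continuous_onI[OF c] borel_measurable_mono[OF mono])
  interpret pair_sigma_finite ?M lborel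
    by (intro pair_sigma_finite.intro sigma_finite_interval_measure m rc sigma_finite_lborel)
  define a where "a = - R"
  have FTC: "(LINT x|lborel. \<phi>' x * indicator {t..R} x) = - \<phi> t" if "t \<le> R" for t
  proof -
    have "(LINT x|lborel. \<phi>' x * indicator {t..R} x) = \<phi> R - \<phi> t"
      using that d c by (intro integral_FTC_Icc_real) (auto simp: continuous_on_eq_continuous_at)
    with R show ?thesis by simp
  qed
  obtain B where B: "0 \<le> B" "\<And>x. \<bar>\<phi>' x\<bar> \<le> B"
    using continuous_compact_support_bounded[OF c, of R] R(3) by (metis less_imp_le)
  \<comment> \<open>Integration over x gives - \<phi> t. The conditions on t describe the half-open
    interval on which \<open>interval_measure\<close> is an increment of \<open>G\<close>.\<close>
  define k where "k t x = \<phi>' x * (if a < t \<and> t \<le> x \<and> x \<le> R then 1 else 0)" for t x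
  have "integrable (?M \<Otimes>\<^sub>M lborel) (case_prod k)"
  proof (rule integrableI_bounded_set[where A = "{a<..R} \<times> {a..R}" and B = B])
    show "{a<..R} \<times> {a..R} \<in> sets (?M \<Otimes>\<^sub>M lborel)"
      by (intro pair_measureI) auto
    show "case_prod k \<in> borel_measurable (?M \<Otimes>\<^sub>M lborel)"
      unfolding k_def by measurable
    show "emeasure (?M \<Otimes>\<^sub>M lborel) ({a<..R} \<times> {a..R}) < \<infinity>"
      using R(1) by (subst lborel.emeasure_pair_measure_Times) (auto simp: Ioc a_def ennreal_mult_less_top)
  qed (use B in \<open>auto simp: k_def split: if_splits\<close>)
  then have "(LINT x|lborel. LINT t|?M. k t x) = (LINT t|?M. LINT x|lborel. k t x)"
    by (rule Fubini_integral)
  moreover have "(LINT x|lborel. k t x) = - \<phi> t" for t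
  proof (cases "a < t \<and> t \<le> R")
    case True
    then have "k t = (\<lambda>x. \<phi>' x * indicator {t..R} x)"
      by (auto simp: k_def fun_eq_iff indicator_def)
    with True FTC[of t] show ?thesis by simp
  next
    case False
    then have "k t = (\<lambda>x. 0)"
      by (auto simp: k_def fun_eq_iff)
    moreover have "R \<le> \<bar>t\<bar>"
      using False R(1) by (auto simp: a_def)
    ultimately show ?thesis
      using R(2) by simp
  qed
  moreover have "(LINT t|?M. k t x) = \<phi>' x * G x - G a * \<phi>' x" for x
  proof (cases "a < x \<and> x < R")
    case True
    then have "(\<lambda>t. k t x) = (\<lambda>t. \<phi>' x * indicator {a<..x} t)"
      by (auto simp: k_def fun_eq_iff indicator_def)
    moreover have "measure ?M {a<..x} = G x - G a"
      using True m rc by (intro measure_interval_measure_Ioc) auto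
    ultimately show ?thesis
      by (simp add: right_diff_distrib mult.commute)
  next
    case False
    then have "R \<le> \<bar>x\<bar>"
      using R(1) by (auto simp: a_def)
    then show ?thesis
      using R(3) by (simp add: k_def)
  qed
  ultimately have "(LINT x|lborel. \<phi>' x * G x - G a * \<phi>' x) = - (LINT t|?M. \<phi> t)"
    by simp
  \<comment> \<open>The constant \<open>G a\<close> drops out because \<phi>' has integral
    0.\<close>
  moreover have "(LINT x|lborel. \<phi>' x * G x - G a * \<phi>' x) = (LINT x|lborel. \<phi>' x * G x)"
  proof -
    have "integrable lborel \<phi>'"
      using R(3) by (intro radon_integrable_continuous[OF radon_lborel c, of R]) auto
    moreover have "integrable lborel (\<lambda>x. \<phi>' x * G x)"
    proof (rule radon_integrable[OF radon_lborel, where R = R and B = "B * (\<bar>G R\<bar> + \<bar>G a\<bar>)"])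
      show "\<bar>\<phi>' x * G x\<bar> \<le> B * (\<bar>G R\<bar> + \<bar>G a\<bar>)" for x
      proof (cases "R \<le> \<bar>x\<bar>")
        case True
        then show ?thesis using R(3) B by simp
      next
        case False
        then have "\<bar>G x\<bar> \<le> \<bar>G R\<bar> + \<bar>G a\<bar>"
          using m[of x R] m[of a x] unfolding a_def by linarith
        with B show ?thesis
          unfolding abs_mult by (intro mult_mono) auto
      qed
    qed (use R(3) in auto)
    moreover have "(LINT x|lborel. \<phi>' x) = 0"
    proof -
      have "\<phi>' = (\<lambda>x. \<phi>' x * indicator {a..R} x)"
        using R(3) by (force simp: fun_eq_iff indicator_def a_def)
      with FTC[of a] R show ?thesis
        by (simp add: a_def)
    qed
    ultimately show ?thesis by simp
  qed
  ultimately show "(LINT x|?M. \<phi> x) = - (LINT x|lborel. \<phi>' x * G x)"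
    by simp
qed

text \<open>Helly selection acts on the cumulative distribution functions \<open>F n\<close>.
  Integration by parts writes the pairing with \<phi> as minus the integral of \<phi>' times
  \<open>F n\<close>, so convergence almost everywhere suffices. Mass may escape to infinity, but
  compactly supported functions do not detect it.\<close>

lemma atomic_measures_subsequence:
  fixes p t :: "nat \<Rightarrow> nat \<Rightarrow> real" and m :: "nat \<Rightarrow> nat"
  assumes p: "\<And>n j. 0 \<le> p n j" "\<And>n. (\<Sum>j = 1..m n. p n j) \<le> C"
  obtains r :: "nat \<Rightarrow> nat" and M where "strict_mono r" "radon M"
    "\<And>\<phi>. test_function \<phi> \<Longrightarrow>
      (\<lambda>n. \<Sum>j = 1..m (r n). p (r n) j * \<phi> (t (r n) j)) \<longlonglongrightarrow> (LINT x|M. \<phi> x)"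
proof -
  define F where "F n x = (\<Sum>j = 1..m n. p n j * indicator {t n j..} x)" for n x
  have rc: "continuous (at_right x) (F n)" for n x
  proof -
    have "((\<lambda>y. indicator {s..} y :: real) \<longlongrightarrow> indicator {s..} x) (at_right x)" for s
    proof (rule tendsto_eventually)
      show "\<forall>\<^sub>F y in at_right x. (indicator {s..} y :: real) = indicator {s..} x"
      proof (cases "s \<le> x")
        case True
        then show ?thesis
          by (auto simp: eventually_at_right_field intro!: exI[of _ "x + 1"])
      next
        case False
        then show ?thesis
          by (auto simp: eventually_at_right_field intro!: exI[of _ s])
      qed
    qed
    then show ?thesis
      unfolding continuous_within F_def[abs_def] by (intro tendsto_intros)
  qed
  have mono: "mono (F n)" for n
    unfolding F_def by (intro monoI sum_mono mult_left_mono p(1)) (auto simp: indicator_def)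
  have F0: "0 \<le> F n x" for n x
    unfolding F_def using p(1) by (intro sum_nonneg mult_nonneg_nonneg) auto
  have bdd: "\<bar>F n x\<bar> \<le> C" for n x
  proof -
    have "F n x \<le> (\<Sum>j = 1..m n. p n j)"
      unfolding F_def using p(1) by (intro sum_mono) (auto simp: indicator_def)
    with F0[of n x] p(2)[of n] show ?thesis by simp
  qed
  obtain r G where r: "strict_mono r" and G: "\<And>x. continuous (at_right x) G" "mono G" "\<And>x. \<bar>G x\<bar> \<le> C"
    and lim: "\<And>x. continuous (at x) G \<Longrightarrow> (\<lambda>n. F (r n) x) \<longlonglongrightarrow> G x"
    using Helly_selection[of F C, OF rc mono bdd] by blast
  have tf: "radon (interval_measure G) \<and>
      (\<lambda>n. \<Sum>j = 1..m (r n). p (r n) j * \<phi> (t (r n) j)) \<longlonglongrightarrow> (LINT x|interval_measure G. \<phi> x)"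
    if \<phi>: "test_function \<phi>" for \<phi>
  proof -
    obtain \<phi>' R where R: "0 < R" and d: "\<And>x. (\<phi> has_real_derivative \<phi>' x) (at x)"
      "\<And>x. (\<phi>' has_real_derivative (deriv ^^ 2) \<phi> x) (at x)" "continuous_on UNIV ((deriv ^^ 2) \<phi>)"
      and z: "\<And>x. R \<le> \<bar>x\<bar> \<Longrightarrow> \<phi> x = 0" "\<And>x. R \<le> \<bar>x\<bar> \<Longrightarrow> \<phi>' x = 0" "\<And>x. R \<le> \<bar>x\<bar> \<Longrightarrow> (deriv ^^ 2) \<phi> x = 0"
      by (rule test_functionE[OF \<phi>], rule that)
    have c: "continuous_on UNIV \<phi>'"
      by (rule DERIV_continuous_on[OF has_field_derivative_at_within[OF d(2)]])
    have [measurable]: "\<phi>' \<in> borel_measurable borel" "G \<in> borel_measurable borel" "F n \<in> borel_measurable borel" for n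
      by (auto intro: borel_measurable_continuous_onI[OF c] borel_measurable_mono G mono)
    obtain B where B: "0 \<le> B" "\<And>x. \<bar>\<phi>' x\<bar> \<le> B"
      using continuous_compact_support_bounded[OF c, of R] z(2) by (metis less_imp_le)
    have atom: "(LINT x|lborel. \<phi>' x * indicator {s..} x) = - \<phi> s"
        "integrable lborel (\<lambda>x. \<phi>' x * indicator {s..} x)" for s
    proof -
      define S where "S = max R \<bar>s\<bar>"
      have S: "s \<le> S" "R \<le> S" "R \<le> \<bar>S\<bar>"
        using R by (auto simp: S_def)
      have "(LINT x|lborel. \<phi>' x * indicator {s..S} x) = \<phi> S - \<phi> s"
        using S d(1) c by (intro integral_FTC_Icc_real) (auto simp: continuous_on_eq_continuous_at)
      also have "(\<lambda>x. \<phi>' x * indicator {s..S} x) = (\<lambda>x. \<phi>' x * indicator {s..} x)"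
      proof
        show "\<phi>' x * indicator {s..S} x = \<phi>' x * indicator {s..} x" for x
          using z(2)[of x] S by (cases "S < x") (auto simp: indicator_def)
      qed
      finally show "(LINT x|lborel. \<phi>' x * indicator {s..} x) = - \<phi> s"
        using z(1)[OF S(3)] by simp
      show "integrable lborel (\<lambda>x. \<phi>' x * indicator {s..} x)"
        by (rule radon_integrable[OF radon_lborel, where R = R and B = B])
          (use B z in \<open>auto simp: indicator_def\<close>)
    qed
    have sum: "(\<Sum>j = 1..m n. p n j * \<phi> (t n j)) = - (LINT x|lborel. \<phi>' x * F n x)" for n
    proof -
      have "(LINT x|lborel. \<phi>' x * F n x) = (LINT x|lborel. (\<Sum>j = 1..m n. p n j * (\<phi>' x * indicator {t n j..} x)))"
        by (simp only: F_def sum_distrib_left mult.left_commute)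
      also have "\<dots> = (\<Sum>j = 1..m n. p n j * (- \<phi> (t n j)))"
        using atom by (simp add: Bochner_Integration.integral_sum)
      finally show ?thesis
        by (simp add: sum_negf)
    qed
    have "(\<lambda>n. LINT x|lborel. \<phi>' x * F (r n) x) \<longlonglongrightarrow> (LINT x|lborel. \<phi>' x * G x)"
    proof (rule integral_dominated_convergence[where w = "\<lambda>x. B * C * indicator {-R..R} x"])
      show "integrable lborel (\<lambda>x. B * C * indicator {- R..R} x)"
        by (intro integrable_mult_right integrable_real_indicator) (simp_all add: emeasure_bounded_finite del: infinity_ennreal_def)
      \<comment> \<open>Helly gives convergence at the continuity points of \<open>G\<close>; a
        monotone function has only countably many others.\<close>
      have "{x. \<not> isCont G x} \<in> null_sets lborel"
        by (intro countable_imp_null_set_lborel mono_ctble_discont G)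
      then have "AE x in lborel. isCont G x"
        by (rule AE_I') auto
      then show "AE x in lborel. (\<lambda>n. \<phi>' x * F (r n) x) \<longlonglongrightarrow> \<phi>' x * G x"
        by eventually_elim (intro tendsto_intros lim)
      show "AE x in lborel. norm (\<phi>' x * F (r n) x) \<le> B * C * indicator {- R..R} x" for n
      proof (intro AE_I2)
        fix x
        have "\<bar>\<phi>' x\<bar> * \<bar>F (r n) x\<bar> \<le> B * C"
          using B bdd by (intro mult_mono) auto
        then show "norm (\<phi>' x * F (r n) x) \<le> B * C * indicator {- R..R} x"
          using z(2)[of x] by (cases "R \<le> \<bar>x\<bar>") (auto simp: abs_mult indicator_def)
      qed
    qed measurable
    then have "(\<lambda>n. \<Sum>j = 1..m (r n). p (r n) j * \<phi> (t (r n) j)) \<longlonglongrightarrow> - (LINT x|lborel. \<phi>' x * G x)"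
      unfolding sum by (rule tendsto_minus)
    with integral_interval_measure[OF G(2,1) d(1) c R z(1,2)] show ?thesis
      by simp
  qed
  \<comment> \<open>The Radon property was obtained together with a test function; the zero function
    provides an instance.\<close>
  have "test_function (\<lambda>x. 0)"
    by (auto simp: test_function_iff smooth_def intro!: exI[of _ "\<lambda>_ _. 0"])
  with tf show thesis
    by (intro that[OF r, of "interval_measure G"]) auto
qed

text \<open>The positive and the negative atoms have bounded total masses, as the weight is at least
  1, so each family has a limit measure along a subsequence. The networks converge to
  \<open>f\<close> uniformly on the support of a test function, which identifies the difference of
  the two limits as the second derivative of \<open>f\<close>.\<close>

lemma ex_deriv2_measure:
  assumes f: "continuous_on UNIV f" and C: "0 \<le> C" "Rbar1 f = ennreal C"
  shows "\<exists>\<mu>. is_deriv2_measure f \<mu>"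
proof -
  obtain m a w b a0 b0 where
    norm: "\<And>n. 1 / 2 * param_norm_sq (m n) (a n) (w n) (b n) \<le> C + 1 / real (Suc n)" and
    net: "\<And>n x. \<bar>x\<bar> \<le> real (Suc n) \<Longrightarrow> \<bar>network (m n) (a n) (w n) (b n) (a0 n) (b0 n) x - f x\<bar> \<le> 1 / real (Suc n)"
    using approximating_networks[OF C] by blast
  define g where "g n = network (m n) (a n) (w n) (b n) (a0 n) (b0 n)" for n
  define t where "t n j = - b n j / w n j" for n j
  define p where "p n j = max 0 (a n j) * \<bar>w n j\<bar>" for n j
  define q where "q n j = max 0 (- a n j) * \<bar>w n j\<bar>" for n j
  have pq0: "0 \<le> p n j" "0 \<le> q n j" for n j
    by (simp_all add: p_def q_def)
  have bound: "(\<Sum>j = 1..m n. p n j) \<le> C + 1" "(\<Sum>j = 1..m n. q n j) \<le> C + 1" for n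
  proof -
    have "1 / real (Suc n) \<le> 1"
      by simp
    then have le: "(\<Sum>j = 1..m n. \<bar>a n j\<bar> * \<bar>w n j\<bar> * weight (- b n j / w n j)) \<le> C + 1"
      using sum_weight_breakpoint_le[of "a n" "w n" "b n" "m n"] norm[of n] by linarith
    have pq: "p n j \<le> \<bar>a n j\<bar> * \<bar>w n j\<bar> * weight (- b n j / w n j)"
      "q n j \<le> \<bar>a n j\<bar> * \<bar>w n j\<bar> * weight (- b n j / w n j)" for j
    proof -
      have "\<bar>a n j\<bar> * \<bar>w n j\<bar> * 1 \<le> \<bar>a n j\<bar> * \<bar>w n j\<bar> * weight (- b n j / w n j)"
        by (intro mult_left_mono weight_ge_1) auto
      moreover have "p n j \<le> \<bar>a n j\<bar> * \<bar>w n j\<bar>" "q n j \<le> \<bar>a n j\<bar> * \<bar>w n j\<bar>"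
        unfolding p_def q_def by (intro mult_right_mono; auto)+
      ultimately show "p n j \<le> \<bar>a n j\<bar> * \<bar>w n j\<bar> * weight (- b n j / w n j)"
        "q n j \<le> \<bar>a n j\<bar> * \<bar>w n j\<bar> * weight (- b n j / w n j)"
        by linarith+
    qed
    show "(\<Sum>j = 1..m n. p n j) \<le> C + 1" "(\<Sum>j = 1..m n. q n j) \<le> C + 1"
      by (rule order_trans[OF sum_mono le], rule pq)+
  qed
  obtain r1 M1 where r1: "strict_mono r1" "radon M1"
    and lim1: "\<And>\<phi>. test_function \<phi> \<Longrightarrow>
      (\<lambda>n. \<Sum>j = 1..m (r1 n). p (r1 n) j * \<phi> (t (r1 n) j)) \<longlonglongrightarrow> (LINT x|M1. \<phi> x)"
    using atomic_measures_subsequence[of p m "C + 1" t, OF pq0(1) bound(1)] by blast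
  \<comment> \<open>The second selection runs along the first subsequence, so both limits hold along
    the composition of \<open>r1\<close> and \<open>r2\<close>.\<close>
  obtain r2 M2 where r2: "strict_mono r2" "radon M2"
    and lim2: "\<And>\<phi>. test_function \<phi> \<Longrightarrow>
      (\<lambda>n. \<Sum>j = 1..m (r1 (r2 n)). q (r1 (r2 n)) j * \<phi> (t (r1 (r2 n)) j)) \<longlonglongrightarrow> (LINT x|M2. \<phi> x)"
    using atomic_measures_subsequence[of "\<lambda>n. q (r1 n)" "\<lambda>n. m (r1 n)" "C + 1" "\<lambda>n. t (r1 n)", OF pq0(2) bound(2)]
    by blast
  obtain \<mu> where \<mu>: "\<And>\<phi> R. continuous_on UNIV \<phi> \<Longrightarrow> (\<And>x. R < \<bar>x\<bar> \<Longrightarrow> \<phi> x = 0) \<Longrightarrow>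
      signed_integral \<mu> \<phi> = (LINT x|M1. \<phi> x) - (LINT x|M2. \<phi> x)"
    using jordan_decomposition[OF r1(2) r2(2)] by blast
  have "distr_deriv2 f \<phi> = signed_integral \<mu> \<phi>" if \<phi>: "test_function \<phi>" for \<phi>
  proof -
    obtain \<phi>' R where R: "0 < R" and d: "\<And>x. (\<phi> has_real_derivative \<phi>' x) (at x)"
      "\<And>x. (\<phi>' has_real_derivative (deriv ^^ 2) \<phi> x) (at x)" and c: "continuous_on UNIV ((deriv ^^ 2) \<phi>)"
      and z: "\<And>x. R \<le> \<bar>x\<bar> \<Longrightarrow> \<phi> x = 0" "\<And>x. R \<le> \<bar>x\<bar> \<Longrightarrow> \<phi>' x = 0" "\<And>x. R \<le> \<bar>x\<bar> \<Longrightarrow> (deriv ^^ 2) \<phi> x = 0"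
      by (rule test_functionE[OF \<phi>], rule that)
    let ?d = "(deriv ^^ 2) \<phi>"
    have int: "integrable lborel (\<lambda>x. u x * ?d x)" if "continuous_on UNIV u" for u
      by (rule radon_integrable_continuous[OF radon_lborel, where R = R])
        (use that c z(3) in \<open>auto intro!: continuous_intros\<close>)
    have cg: "continuous_on UNIV (g n)" for n
      unfolding g_def network_def[abs_def] by (intro continuous_intros)
    have idabs: "integrable lborel (\<lambda>x. \<bar>?d x\<bar>)"
      using int[of "\<lambda>x. 1"] by (intro integrable_abs) simp
    \<comment> \<open>As soon as n + 1 exceeds R, the error on the support is at most 1 / (n + 1),
      multiplied by the integral of \<bar>\<phi>''\<bar>.\<close>
    have "(\<lambda>n. distr_deriv2 (g n) \<phi> - distr_deriv2 f \<phi>) \<longlonglongrightarrow> 0"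
    proof (rule Lim_null_comparison)
      show "\<forall>\<^sub>F n in sequentially. norm (distr_deriv2 (g n) \<phi> - distr_deriv2 f \<phi>) \<le>
          (LINT x|lborel. \<bar>?d x\<bar>) / real (Suc n)"
        using eventually_abs_le_real_Suc[of R]
      proof eventually_elim
        case (elim n)
        have "norm (distr_deriv2 (g n) \<phi> - distr_deriv2 f \<phi>) = \<bar>LINT x|lborel. (g n x - f x) * ?d x\<bar>"
          unfolding distr_deriv2_def using int[OF cg] int[OF f] by (simp add: left_diff_distrib)
        also have "\<dots> \<le> (LINT x|lborel. \<bar>(g n x - f x) * ?d x\<bar>)"
          by (rule integral_abs_bound)
        also have "\<dots> \<le> (LINT x|lborel. 1 / real (Suc n) * \<bar>?d x\<bar>)"
        proof (rule integral_mono)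
          show "integrable lborel (\<lambda>x. \<bar>(g n x - f x) * ?d x\<bar>)"
            by (intro integrable_abs int continuous_intros cg f)
          show "integrable lborel (\<lambda>x. 1 / real (Suc n) * \<bar>?d x\<bar>)"
            using idabs by (intro integrable_mult_right) auto
          show "\<bar>(g n x - f x) * ?d x\<bar> \<le> 1 / real (Suc n) * \<bar>?d x\<bar>" for x
          proof (cases "R \<le> \<bar>x\<bar>")
            case True
            then show ?thesis by (simp add: z(3))
          next
            case False
            then show ?thesis
              unfolding abs_mult g_def using elim by (intro mult_right_mono net) auto
          qed
        qed
        finally show ?case by simp
      qed
      show "(\<lambda>n. (LINT x|lborel. \<bar>?d x\<bar>) / real (Suc n)) \<longlonglongrightarrow> 0"
        by (rule LIMSEQ_Suc[OF lim_const_over_n])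
    qed
    then have "(\<lambda>n. distr_deriv2 (g n) \<phi>) \<longlonglongrightarrow> distr_deriv2 f \<phi>"
      by (simp add: LIM_zero_iff)
    then have "(\<lambda>n. distr_deriv2 (g (r1 (r2 n))) \<phi>) \<longlonglongrightarrow> distr_deriv2 f \<phi>"
      using LIMSEQ_subseq_LIMSEQ[OF _ strict_mono_o[OF r1(1) r2(1)]] by (auto simp: comp_def)
    moreover have "distr_deriv2 (g n) \<phi> = (\<Sum>j = 1..m n. p n j * \<phi> (t n j)) - (\<Sum>j = 1..m n. q n j * \<phi> (t n j))" for n
    proof -
      have "a n j * \<bar>w n j\<bar> * \<phi> (t n j) = p n j * \<phi> (t n j) - q n j * \<phi> (t n j)" for j
        by (auto simp: p_def q_def max_def)
      then show ?thesis
        unfolding g_def distr_deriv2_network[OF \<phi>] t_def[symmetric] by (simp add: sum_subtractf)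
    qed
    moreover have "(\<lambda>n. \<Sum>j = 1..m (r1 (r2 n)). p (r1 (r2 n)) j * \<phi> (t (r1 (r2 n)) j)) \<longlonglongrightarrow> (LINT x|M1. \<phi> x)"
      using LIMSEQ_subseq_LIMSEQ[OF lim1[OF \<phi>] r2(1)] by (simp add: comp_def)
    moreover note lim2[OF \<phi>]
    ultimately have "distr_deriv2 f \<phi> = (LINT x|M1. \<phi> x) - (LINT x|M2. \<phi> x)"
      by (simp add: LIMSEQ_unique tendsto_diff)
    also have "\<dots> = signed_integral \<mu> \<phi>"
      using z(1) by (intro \<mu>[symmetric, of _ R] DERIV_continuous_on[OF has_field_derivative_at_within[OF d(1)]]) auto
    finally show ?thesis .
  qed
  then show ?thesis
    by (auto simp: is_deriv2_measure_def)
qed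

theorem theorem1:
  fixes f :: "real \<Rightarrow> real"
  shows "((\<exists>L. L-lipschitz_on UNIV f) \<longrightarrow> Rbar1 f = weighted_tv_deriv2 f) \<and>
         (\<not> (\<exists>L. L-lipschitz_on UNIV f) \<longrightarrow> Rbar1 f = \<infinity>)"
proof (intro conjI impI)
  assume "\<exists>L. L-lipschitz_on UNIV f"
  then obtain L where L: "L-lipschitz_on UNIV f" ..
  then have f: "continuous_on UNIV f"
    by (rule lipschitz_on_continuous_on)
  show "Rbar1 f = weighted_tv_deriv2 f"
  proof (cases "\<exists>\<mu>. is_deriv2_measure f \<mu>")
    case True
    \<comment> \<open>The two bounds hold for every representing measure, in particular for the one
      chosen in \<open>weighted_tv_deriv2\<close>.\<close>
    define \<mu> where "\<mu> = (SOME \<mu>. is_deriv2_measure f \<mu>)"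
    have \<mu>: "is_deriv2_measure f \<mu>"
      unfolding \<mu>_def using True by (rule someI_ex)
    have W: "weighted_tv_deriv2 f = (\<integral>\<^sup>+ x. ennreal (weight x) \<partial>total_variation \<mu>)"
      using True by (simp add: weighted_tv_deriv2_def \<mu>_def weight_def)
    show ?thesis
      unfolding W
    proof (rule antisym)
      show "Rbar1 f \<le> (\<integral>\<^sup>+ x. ennreal (weight x) \<partial>total_variation \<mu>)"
        by (intro Rbar1_le approx_cost_le_weighted_tv[OF L \<mu>])
      show "(\<integral>\<^sup>+ x. ennreal (weight x) \<partial>total_variation \<mu>) \<le> Rbar1 f"
      proof (cases "Rbar1 f")
        case (real C)
        with weighted_tv_le_Rbar1[OF _ _ f \<mu>, of C] show ?thesis by simp
      qed simp
    qed
  next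
    case False
    \<comment> \<open>A finite cost would produce a representing measure.\<close>
    then have "Rbar1 f = \<infinity>"
      using ex_deriv2_measure[OF f] by (cases "Rbar1 f") auto
    with False show ?thesis
      by (simp add: weighted_tv_deriv2_def)
  qed
next
  assume "\<not> (\<exists>L. L-lipschitz_on UNIV f)"
  then show "Rbar1 f = \<infinity>"
    using lipschitz_if_Rbar1_finite by (cases "Rbar1 f") auto
qed

end
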